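(* Let $b,\sigma:[0,\infty)\times\mathbb{R}\to\mathbb{R}$, let $1/2<\gamma\le 1$, let $g\in\mathcal{C}^{\gamma}(\mathbb{R})$, and let $x_0\in\mathbb{R}$. Suppose $b$ is globally Lipschitz in $t$ and $x$, and $\sigma\in C^1([0,\infty)\times\mathbb{R})$ with $\sigma$, $\sigma'_t$, $\sigma'_x$ globally Lipschitz in $t$ and $x$. Then for every $T>0$ and every $\beta$ with $\gamma>\beta>1-\gamma$, the ordinary differential equation $$dx(t)=b(t,x(t))\,dt+\sigma(t,x(t))\,dg(t),\qquad x(0)=x_0,$$ has a unique solution in $\mathcal{C}^{\beta}([0,T])$.
   Context: $\mathcal{C}^{\beta}(I)$ denotes the space of real-valued H\"older-continuous functions on the interval $I$ with exponent $\beta$. $\sigma'_t$ and $\sigma'_x$ are the partial derivatives of $\sigma=\sigma(t,x)$. A solution in $\mathcal{C}^\beta([0,T])$ is a function $x\in\mathcal{C}^\beta([0,T])$ such that $x(t)=x_0+\int_0^t b(\tau,x(\tau))\,d\tau+\int_0^t\sigma(\tau,x(\tau))\,dg(\tau)$ for all $t\in[0,T]$, the last integral being a Stieltjes integral (limit of Riemann sums as the mesh tends to $0$), which exists since $\beta+\gamma>1$. *)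

theory Defs
  imports "HOL-Analysis.Analysis"
begin

definition holder_on :: "real \<Rightarrow> real set \<Rightarrow> (real \<Rightarrow> real) \<Rightarrow> bool" where
  "holder_on \<beta> I f \<longleftrightarrow> (\<exists>C. \<forall>s\<in>I. \<forall>t\<in>I. \<bar>f s - f t\<bar> \<le> C * \<bar>s - t\<bar> powr \<beta>)"

text \<open>Riemann-Stieltjes sums. A tagged division is a set of pairs of a tag and a compact interval
  containing it, and \<open>Inf K\<close> and \<open>Sup K\<close> are the endpoints of \<open>K\<close>. Degenerate intervals are
  allowed and contribute zero.\<close>

definition stieltjes_sum :: "(real \<Rightarrow> real) \<Rightarrow> (real \<Rightarrow> real) \<Rightarrow> (real \<times> real set) set \<Rightarrow> real" where
  "stieltjes_sum f g p = (\<Sum>(\<xi>, K)\<in>p. f \<xi> * (g (Sup K) - g (Inf K)))"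

text \<open>The limit is over a uniform mesh size \<open>\<delta>\<close> (not over gauges), with arbitrary tags.\<close>

definition has_stieltjes_integral ::
    "(real \<Rightarrow> real) \<Rightarrow> (real \<Rightarrow> real) \<Rightarrow> real \<Rightarrow> real \<Rightarrow> real \<Rightarrow> bool" where
  "has_stieltjes_integral f g a b J \<longleftrightarrow>
     (\<forall>\<epsilon>>0. \<exists>\<delta>>0. \<forall>p. p tagged_division_of {a..b} \<and> (\<forall>(\<xi>, K)\<in>p. Sup K - Inf K < \<delta>) \<longrightarrow>
        \<bar>stieltjes_sum f g p - J\<bar> < \<epsilon>)"

text \<open>Functions on \<open>[0,T]\<close> are total functions whose values outside \<open>[0,T]\<close> are irrelevant.
  The initial condition \<open>x 0 = x0\<close> is the integral equation at \<open>t = 0\<close>.\<close>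

definition holder_solution ::
    "(real \<Rightarrow> real \<Rightarrow> real) \<Rightarrow> (real \<Rightarrow> real \<Rightarrow> real) \<Rightarrow> (real \<Rightarrow> real) \<Rightarrow> real \<Rightarrow> real \<Rightarrow> real \<Rightarrow>
      (real \<Rightarrow> real) \<Rightarrow> bool" where
  "holder_solution b \<sigma> g x0 \<beta> T x \<longleftrightarrow>
     holder_on \<beta> {0..T} x \<and>
     (\<forall>t\<in>{0..T}. \<exists>J. has_stieltjes_integral (\<lambda>\<tau>. \<sigma> \<tau> (x \<tau>)) g 0 t J \<and>
        x t = x0 + integral {0..t} (\<lambda>\<tau>. b \<tau> (x \<tau>)) + J)"

text \<open>Joint global Lipschitz continuity on \<open>[0,\<infinity>) \<times> \<real>\<close>; values at negative times are irrelevant.\<close>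

definition globally_lipschitz :: "(real \<Rightarrow> real \<Rightarrow> real) \<Rightarrow> bool" where
  "globally_lipschitz f \<longleftrightarrow> (\<exists>L. L-lipschitz_on ({0..} \<times> UNIV) (\<lambda>(t, x). f t x))"

text \<open>\<open>\<sigma>\<close> is continuously differentiable on \<open>[0,\<infinity>) \<times> \<real>\<close> with partial derivatives \<open>\<sigma>t\<close> and \<open>\<sigma>x\<close>;
  at \<open>t = 0\<close> the time derivative is one-sided.\<close>

definition C1_with_partials ::
    "(real \<Rightarrow> real \<Rightarrow> real) \<Rightarrow> (real \<Rightarrow> real \<Rightarrow> real) \<Rightarrow> (real \<Rightarrow> real \<Rightarrow> real) \<Rightarrow> bool" where
  "C1_with_partials \<sigma> \<sigma>t \<sigma>x \<longleftrightarrow>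
     (\<forall>t\<ge>0. \<forall>x. ((\<lambda>s. \<sigma> s x) has_real_derivative \<sigma>t t x) (at t within {0..})) \<and>
     (\<forall>t\<ge>0. \<forall>x. ((\<lambda>y. \<sigma> t y) has_real_derivative \<sigma>x t x) (at x)) \<and>
     continuous_on ({0..} \<times> UNIV) (\<lambda>(t, x). \<sigma>t t x) \<and>
     continuous_on ({0..} \<times> UNIV) (\<lambda>(t, x). \<sigma>x t x)"

end

theory Submission
  imports Defs
begin

text \<open>
  Write \<open>\<theta> = \<beta> + \<gamma>\<close>, so that \<open>\<theta> > 1\<close>. The whole proof rests on replacing the Stieltjes integral by a
  local inequality: \<open>F\<close> is a primitive of \<open>f\<close> against \<open>g\<close> if \<open>F t - F s\<close> differs from
  \<open>f s * (g t - g s)\<close> by \<open>O((t - s)\<^sup>\<theta>)\<close>. As \<open>\<theta> > 1\<close>, errors of this size vanish when summed over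
  fine divisions, and all Riemann sums converge to the increments of \<open>F\<close>
  (\<open>young_primitive_has_stieltjes_integral\<close>). The inequality also improves itself: whatever the
  constant hidden in the \<open>O\<close>, halving the interval again and again reduces it to a multiple of the
  product of the Hoelder constants of \<open>f\<close> and \<open>g\<close> (\<open>sewing_bound\<close>, \<open>young_primitive_bound\<close>).
  For smooth \<open>g\<close> a primitive is \<open>\<integral> f g'\<close>; the improved constant does not see the smoothness, so
  primitives for mollifications of \<open>g\<close> converge, and this gives a primitive for every Hoelder
  integrator (\<open>young_primitive_exists\<close>).

  The equation then becomes a fixed point problem for the map that sends \<open>x\<close> to
  \<open>x0 + \<integral> b(\<tau>, x \<tau>) d\<tau> + \<integral> \<sigma>(\<tau>, x \<tau>) dg(\<tau>)\<close>. On an interval of length at most \<open>h\<close> the bound on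
  the increments of the image gains a factor of order \<open>h\<^sup>\<gamma>\<close> over that of \<open>x\<close>, apart from a term
  independent of \<open>x\<close>. To use this on all of \<open>[0, T]\<close> at once, without glueing local solutions,
  increments are measured only over distances up to \<open>h\<close> and against the weight \<open>2\<^sup>t\<^sup>/\<^sup>h\<close>, which
  doubles at each step and so absorbs the accumulation of the earlier steps
  (\<open>weighted_holder_sup_bound\<close>).

  The map is of affine growth, so for a suitable \<open>h\<close> it preserves a ball
  (\<open>integral_image_invariant\<close>). It is not globally Lipschitz in the Hoelder
  norm: the increments of \<open>\<sigma>(\<tau>, x \<tau>) - \<sigma>(\<tau>, y \<tau>)\<close> involve those of \<open>x\<close> and \<open>y\<close> themselves, multiplied by
  \<open>x - y\<close> (\<open>\<sigma>_four_point\<close>). But once these have a common Hoelder constant, a second choice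
  of \<open>h\<close> makes the map a contraction (\<open>integral_image_contraction\<close>). Uniqueness follows by
  applying the contraction to two solutions, existence by iterating the map inside the ball.
\<close>

section \<open>Hoelder bounds\<close>

text \<open>The constant and the set are kept explicit: the estimates for the Young integral use the Hoelder
  constant of the integrand on the interval of integration alone.\<close>

definition holder_bound :: "real \<Rightarrow> real \<Rightarrow> real set \<Rightarrow> (real \<Rightarrow> real) \<Rightarrow> bool" where
  "holder_bound \<beta> C S f \<longleftrightarrow> (\<forall>s\<in>S. \<forall>t\<in>S. s \<le> t \<longrightarrow> \<bar>f t - f s\<bar> \<le> C * (t - s) powr \<beta>)"

lemma holder_boundD:
  "holder_bound \<beta> C S f \<Longrightarrow> s \<in> S \<Longrightarrow> t \<in> S \<Longrightarrow> s \<le> t \<Longrightarrow> \<bar>f t - f s\<bar> \<le> C * (t - s) powr \<beta>"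
  unfolding holder_bound_def by blast

lemma holder_bound_abs:
  assumes "holder_bound \<beta> C S f" "s \<in> S" "t \<in> S"
  shows "\<bar>f t - f s\<bar> \<le> C * \<bar>t - s\<bar> powr \<beta>"
  using holder_boundD[OF assms(1), of s t] holder_boundD[OF assms(1), of t s] assms(2,3)
  by (cases "s \<le> t") (auto simp: abs_minus_commute)

lemma holder_bound_subset: "holder_bound \<beta> C S f \<Longrightarrow> S' \<subseteq> S \<Longrightarrow> holder_bound \<beta> C S' f"
  unfolding holder_bound_def by blast

lemma holder_bound_mono:
  assumes "holder_bound \<beta> C S f" "C \<le> D"
  shows "holder_bound \<beta> D S f"
  using assms mult_right_mono[OF assms(2) powr_ge_zero] unfolding holder_bound_def
  by (meson order.trans)

lemma holder_bound_diff:
  assumes "holder_bound \<beta> C S f" "holder_bound \<beta> C S f'"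
  shows "holder_bound \<beta> (2 * C) S (\<lambda>t. f t - f' t)"
  unfolding holder_bound_def
proof (intro ballI impI)
  fix s t assume "s \<in> S" "t \<in> S" "s \<le> t"
  then show "\<bar>f t - f' t - (f s - f' s)\<bar> \<le> 2 * C * (t - s) powr \<beta>"
    using holder_boundD[OF assms(1), of s t] holder_boundD[OF assms(2), of s t] by linarith
qed

lemma holder_on_iff_holder_bound:
  "holder_on \<beta> S f \<longleftrightarrow> (\<exists>C\<ge>0. holder_bound \<beta> C S f)"
proof
  assume "holder_on \<beta> S f"
  then obtain C where C: "\<And>s t. s \<in> S \<Longrightarrow> t \<in> S \<Longrightarrow> \<bar>f s - f t\<bar> \<le> C * \<bar>s - t\<bar> powr \<beta>"
    unfolding holder_on_def by blast
  have "holder_bound \<beta> \<bar>C\<bar> S f"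
    unfolding holder_bound_def
  proof (intro ballI impI)
    fix s t assume "s \<in> S" "t \<in> S" "s \<le> t"
    then have "\<bar>f t - f s\<bar> \<le> C * (t - s) powr \<beta>" using C[of t s] by simp
    also have "\<dots> \<le> \<bar>C\<bar> * (t - s) powr \<beta>" by (intro mult_right_mono) auto
    finally show "\<bar>f t - f s\<bar> \<le> \<bar>C\<bar> * (t - s) powr \<beta>" .
  qed
  then show "\<exists>C\<ge>0. holder_bound \<beta> C S f" by (intro exI[of _ "\<bar>C\<bar>"]) auto
next
  assume "\<exists>C\<ge>0. holder_bound \<beta> C S f"
  then show "holder_on \<beta> S f"
    unfolding holder_on_def by (metis holder_bound_abs)
qed

lemma holder_bound_continuous_on:
  assumes "holder_bound \<beta> C S f" "0 < \<beta>"
  shows "continuous_on S f"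
proof -
  have "(f \<longlongrightarrow> f s) (at s within S)" if "s \<in> S" for s
  proof -
    have "((\<lambda>t. \<bar>t - s\<bar>) \<longlongrightarrow> 0) (at s within S)"
      by (auto intro!: tendsto_eq_intros)
    then have "((\<lambda>t. \<bar>t - s\<bar> powr \<beta>) \<longlongrightarrow> 0) (at s within S)"
      by (rule tendsto_zero_powrI[OF _ tendsto_const _ assms(2)]) simp
    then have "((\<lambda>t. C * \<bar>t - s\<bar> powr \<beta>) \<longlongrightarrow> 0) (at s within S)"
      by (rule tendsto_mult_right_zero)
    then have "((\<lambda>t. f t - f s) \<longlongrightarrow> 0) (at s within S)"
      by (rule Lim_null_comparison[rotated])
        (use holder_bound_abs[OF assms(1) that] in \<open>auto simp: eventually_at_filter\<close>)
    then show ?thesis by (rule Lim_null[THEN iffD2])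
  qed
  then show ?thesis by (simp add: continuous_on_def)
qed

section \<open>Young primitives\<close>

text \<open>Splitting at the midpoint replaces a constant \<open>C\<close> by
  \<open>q * C + B\<close> with \<open>q = 2 powr (1 - \<theta>)\<close>, because \<open>2 * ((t - s) / 2) powr \<theta> = q * (t - s) powr \<theta>\<close>. Since
  \<open>q < 1\<close>, iterating this drives any initial constant to the fixed point \<open>B / (1 - q)\<close>.\<close>

lemma sewing_bound:
  fixes R :: "real \<Rightarrow> real \<Rightarrow> real"
  assumes \<theta>: "1 < \<theta>" and B: "0 \<le> B"
    and rough: "\<And>s t. a \<le> s \<Longrightarrow> s \<le> t \<Longrightarrow> t \<le> b \<Longrightarrow> \<bar>R s t\<bar> \<le> C * (t - s) powr \<theta>"
    and defect: "\<And>s t. a \<le> s \<Longrightarrow> s \<le> t \<Longrightarrow> t \<le> b \<Longrightarrow>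
      \<bar>R s t - R s ((s + t) / 2) - R ((s + t) / 2) t\<bar> \<le> B * (t - s) powr \<theta>"
    and st: "a \<le> s" "s \<le> t" "t \<le> b"
  shows "\<bar>R s t\<bar> \<le> B / (1 - 2 powr (1 - \<theta>)) * (t - s) powr \<theta>"
proof -
  define q :: real where "q = 2 powr (1 - \<theta>)"
  have q: "0 < q" "q < 1"
    using \<theta> by (auto simp: q_def powr_less_one)
  define K where "K = B / (1 - q)"
  have K: "0 \<le> K" "B + q * K = K" using q B by (auto simp: K_def field_simps)
  have half: "2 * ((t - s) / 2) powr \<theta> = q * (t - s) powr \<theta>" if "s \<le> t" for s t :: real
    using that by (simp add: q_def powr_divide powr_diff)
  have iter: "\<bar>R s t\<bar> \<le> (q ^ n * C + K) * (t - s) powr \<theta>" if "a \<le> s" "s \<le> t" "t \<le> b" for n s t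
    using that
  proof (induction n arbitrary: s t)
    case 0
    have "C * (t - s) powr \<theta> \<le> (C + K) * (t - s) powr \<theta>" using K by (intro mult_right_mono) auto
    then show ?case using rough[OF 0] by simp
  next
    case (Suc n)
    let ?C = "q ^ n * C + K"
    define m where "m = (s + t) / 2"
    have m: "s \<le> m" "m \<le> t" "m - s = (t - s) / 2" "t - m = (t - s) / 2"
      using Suc.prems(2) by (simp_all add: m_def field_simps)
    have left: "\<bar>R s m\<bar> \<le> ?C * ((t - s) / 2) powr \<theta>"
      using Suc.IH[of s m] Suc.prems m by simp
    have right: "\<bar>R m t\<bar> \<le> ?C * ((t - s) / 2) powr \<theta>"
      using Suc.IH[of m t] Suc.prems m by simp
    have "\<bar>R s t\<bar> \<le> \<bar>R s t - R s m - R m t\<bar> + \<bar>R s m\<bar> + \<bar>R m t\<bar>" by arith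
    also have "\<dots> \<le> B * (t - s) powr \<theta> + ?C * ((t - s) / 2) powr \<theta> + ?C * ((t - s) / 2) powr \<theta>"
      using defect[OF Suc.prems] left right unfolding m_def by (intro add_mono)
    also have "\<dots> = B * (t - s) powr \<theta> + ?C * (2 * ((t - s) / 2) powr \<theta>)"
      by (simp only: mult_2 distrib_left add.assoc)
    also have "\<dots> = (B + q * ?C) * (t - s) powr \<theta>"
      unfolding half[OF Suc.prems(2)] distrib_right distrib_left by (simp only: mult_ac)
    also have "B + q * ?C = q ^ Suc n * C + K"
      by (subst (2) K(2)[symmetric]) (simp add: distrib_left)
    finally show ?case .
  qed
  have "(\<lambda>n. (q ^ n * C + K) * (t - s) powr \<theta>) \<longlonglongrightarrow> (0 * C + K) * (t - s) powr \<theta>"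
    using q by (intro tendsto_intros LIMSEQ_power_zero) auto
  then have "\<bar>R s t\<bar> \<le> (0 * C + K) * (t - s) powr \<theta>"
    by (rule LIMSEQ_le_const) (use iter st in blast)
  then show ?thesis by (simp add: K_def q_def)
qed

text \<open>The role of \<open>\<integral>\<^sub>0\<^sup>t f dg\<close>: every germ \<open>f s * (g t - g s)\<close> approximates the increment of \<open>F\<close> to an order
  above one.\<close>

definition young_primitive ::
    "real \<Rightarrow> real \<Rightarrow> (real \<Rightarrow> real) \<Rightarrow> (real \<Rightarrow> real) \<Rightarrow> (real \<Rightarrow> real) \<Rightarrow> bool" where
  "young_primitive \<theta> T f g F \<longleftrightarrow> F 0 = 0 \<and>
     (\<exists>C. \<forall>s t. 0 \<le> s \<and> s \<le> t \<and> t \<le> T \<longrightarrow>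
        \<bar>F t - F s - f s * (g t - g s)\<bar> \<le> C * (t - s) powr \<theta>)"

lemma young_primitive_diff:
  assumes "young_primitive \<theta> T f g F" "young_primitive \<theta> T f' g F'"
  shows "young_primitive \<theta> T (\<lambda>t. f t - f' t) g (\<lambda>t. F t - F' t)"
proof -
  obtain C C' where
    C: "\<And>s t. 0 \<le> s \<and> s \<le> t \<and> t \<le> T \<Longrightarrow> \<bar>F t - F s - f s * (g t - g s)\<bar> \<le> C * (t - s) powr \<theta>" and
    C': "\<And>s t. 0 \<le> s \<and> s \<le> t \<and> t \<le> T \<Longrightarrow> \<bar>F' t - F' s - f' s * (g t - g s)\<bar> \<le> C' * (t - s) powr \<theta>"
    using assms unfolding young_primitive_def by blast
  have "\<bar>F t - F' t - (F s - F' s) - (f s - f' s) * (g t - g s)\<bar> \<le> (C + C') * (t - s) powr \<theta>"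
    if "0 \<le> s \<and> s \<le> t \<and> t \<le> T" for s t
    using C[OF that] C'[OF that] unfolding distrib_right left_diff_distrib by linarith
  then show ?thesis using assms unfolding young_primitive_def by auto
qed

lemma young_primitive_diff_integrator:
  assumes "young_primitive \<theta> T f g F" "young_primitive \<theta> T f g' F'"
  shows "young_primitive \<theta> T f (\<lambda>t. g t - g' t) (\<lambda>t. F t - F' t)"
proof -
  obtain C C' where
    C: "\<And>s t. 0 \<le> s \<and> s \<le> t \<and> t \<le> T \<Longrightarrow> \<bar>F t - F s - f s * (g t - g s)\<bar> \<le> C * (t - s) powr \<theta>" and
    C': "\<And>s t. 0 \<le> s \<and> s \<le> t \<and> t \<le> T \<Longrightarrow> \<bar>F' t - F' s - f s * (g' t - g' s)\<bar> \<le> C' * (t - s) powr \<theta>"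
    using assms unfolding young_primitive_def by blast
  have "\<bar>F t - F' t - (F s - F' s) - f s * (g t - g' t - (g s - g' s))\<bar> \<le> (C + C') * (t - s) powr \<theta>"
    if "0 \<le> s \<and> s \<le> t \<and> t \<le> T" for s t
    using C[OF that] C'[OF that] unfolding distrib_right right_diff_distrib by linarith
  then show ?thesis using assms unfolding young_primitive_def by auto
qed

text \<open>The Hoelder bounds are only required on \<open>{s..t}\<close>. This locality is what later allows the weight to be
  taken at the right endpoint. The midpoint defect of the remainder is the product
  \<open>(f m - f u) * (g v - g m)\<close>, which is where the two exponents add up.\<close>

lemma young_primitive_bound:
  assumes F: "young_primitive (\<beta> + \<gamma>) T f g F" and \<theta>: "1 < \<beta> + \<gamma>" "0 \<le> \<beta>" "0 \<le> \<gamma>"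
    and f: "holder_bound \<beta> A {s..t} f" and g: "holder_bound \<gamma> G {s..t} g" and AG: "0 \<le> A" "0 \<le> G"
    and st: "0 \<le> s" "s \<le> t" "t \<le> T"
  shows "\<bar>F t - F s - f s * (g t - g s)\<bar> \<le> A * G / (1 - 2 powr (1 - (\<beta> + \<gamma>))) * (t - s) powr (\<beta> + \<gamma>)"
proof -
  obtain C where
    C: "\<And>s t. 0 \<le> s \<and> s \<le> t \<and> t \<le> T \<Longrightarrow> \<bar>F t - F s - f s * (g t - g s)\<bar> \<le> C * (t - s) powr (\<beta> + \<gamma>)"
    using F unfolding young_primitive_def by blast
  define R where "R u v = F v - F u - f u * (g v - g u)" for u v
  have "\<bar>R s t\<bar> \<le> A * G / (1 - 2 powr (1 - (\<beta> + \<gamma>))) * (t - s) powr (\<beta> + \<gamma>)"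
  proof (rule sewing_bound[where a = s and b = t and C = C])
    show "\<bar>R u v\<bar> \<le> C * (v - u) powr (\<beta> + \<gamma>)" if "s \<le> u" "u \<le> v" "v \<le> t" for u v
      unfolding R_def using C st that by auto
    show "\<bar>R u v - R u ((u + v) / 2) - R ((u + v) / 2) v\<bar> \<le> A * G * (v - u) powr (\<beta> + \<gamma>)"
      if "s \<le> u" "u \<le> v" "v \<le> t" for u v
    proof -
      let ?m = "(u + v) / 2"
      have "R u v - R u ?m - R ?m v = (f ?m - f u) * (g v - g ?m)"
        by (simp add: R_def algebra_simps)
      also have "\<bar>\<dots>\<bar> \<le> (A * (?m - u) powr \<beta>) * (G * (v - ?m) powr \<gamma>)"
        unfolding abs_mult using that AG
        by (intro mult_mono holder_boundD[OF f] holder_boundD[OF g]) auto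
      also have "\<dots> \<le> (A * (v - u) powr \<beta>) * (G * (v - u) powr \<gamma>)"
        using that AG \<theta> by (intro mult_mono powr_mono2) auto
      finally show ?thesis by (simp add: powr_add mult_ac)
    qed
  qed (use AG st \<theta> in auto)
  then show ?thesis by (simp add: R_def)
qed

section \<open>Existence of Young primitives\<close>

text \<open>The remainder on \<open>{s..t}\<close> is the integral of \<open>(f \<tau> - f s) * g' \<tau>\<close>, hence of order \<open>1 + \<beta>\<close>. Its constant
  depends on the size of \<open>g'\<close>, which blows up as a mollification is refined; this does no harm because
  \<open>young_primitive_bound\<close> discards that constant.\<close>

lemma young_primitive_smooth:
  assumes f: "holder_bound \<beta> A {0..T} f" and \<beta>: "0 < \<beta>" and \<theta>: "\<theta> \<le> 1 + \<beta>" and A: "0 \<le> A"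
    and g: "\<And>t. t \<in> {0..T} \<Longrightarrow> (g has_real_derivative g' t) (at t within {0..T})"
    and g': "continuous_on {0..T} g'" and T: "0 < T"
  shows "young_primitive \<theta> T f g (\<lambda>t. integral {0..t} (\<lambda>\<tau>. f \<tau> * g' \<tau>))"
proof -
  define F where "F t = integral {0..t} (\<lambda>\<tau>. f \<tau> * g' \<tau>)" for t
  have cont: "continuous_on {0..T} (\<lambda>\<tau>. f \<tau> * g' \<tau>)"
    by (intro continuous_on_mult g' holder_bound_continuous_on[OF f \<beta>])
  have F: "(F has_real_derivative f t * g' t) (at t within {0..T})" if "t \<in> {0..T}" for t
    unfolding F_def using integral_has_real_derivative[OF cont that] .
  have "compact (g' ` {0..T})" using g' by (intro compact_continuous_image) auto
  then obtain N where N: "0 < N" "\<And>t. t \<in> {0..T} \<Longrightarrow> \<bar>g' t\<bar> \<le> N"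
    using compact_imp_bounded bounded_pos by (metis image_eqI real_norm_def)
  have "\<bar>F t - F s - f s * (g t - g s)\<bar> \<le> A * N * max 1 T powr (1 + \<beta> - \<theta>) * (t - s) powr \<theta>"
    if st: "0 \<le> s \<and> s \<le> t \<and> t \<le> T" for s t
  proof -
    have "((\<lambda>r. F r - f s * g r) has_derivative (\<lambda>d. (f r * g' r - f s * g' r) * d)) (at r within {s..t})"
      if "r \<in> {s..t}" for r
      using that st
      by (intro has_field_derivative_imp_has_derivative DERIV_subset[where s = "{0..T}" and t = "{s..t}"]
          DERIV_diff F DERIV_cmult g) auto
    moreover have "onorm (\<lambda>d. (f r * g' r - f s * g' r) * d) \<le> A * (t - s) powr \<beta> * N" if "r \<in> {s..t}" for r
    proof (rule onorm_le)
      fix d :: real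
      have "\<bar>f r - f s\<bar> \<le> A * (r - s) powr \<beta>" using st that by (intro holder_boundD[OF f]) auto
      also have "\<dots> \<le> A * (t - s) powr \<beta>" using st that A \<beta> by (intro mult_left_mono powr_mono2) auto
      finally have "\<bar>f r - f s\<bar> * \<bar>g' r\<bar> \<le> (A * (t - s) powr \<beta>) * N"
        using st that A by (intro mult_mono N) auto
      then show "norm ((f r * g' r - f s * g' r) * d) \<le> A * (t - s) powr \<beta> * N * norm d"
        by (simp add: abs_mult mult_right_mono flip: left_diff_distrib)
    qed
    ultimately have "norm ((F t - f s * g t) - (F s - f s * g s)) \<le> A * (t - s) powr \<beta> * N * norm (t - s)"
      using st by (intro differentiable_bound[where S = "{s..t}"]) auto
    also have "A * (t - s) powr \<beta> * N * norm (t - s) = A * N * (t - s) powr (1 + \<beta>)"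
      using st by (simp add: powr_add)
    also have "(t - s) powr (1 + \<beta>) = (t - s) powr (1 + \<beta> - \<theta>) * (t - s) powr \<theta>"
      by (simp flip: powr_add)
    also have "A * N * \<dots> \<le> A * N * (max 1 T powr (1 + \<beta> - \<theta>) * (t - s) powr \<theta>)"
      using A N st \<theta> by (intro mult_left_mono mult_right_mono powr_mono2) auto
    finally show ?thesis by (simp add: algebra_simps)
  qed
  moreover have "F 0 = 0" by (simp add: F_def)
  ultimately show ?thesis unfolding young_primitive_def F_def[symmetric] by blast
qed

text \<open>The mollification is the mean of \<open>g\<close> over \<open>[t, t + \<epsilon>]\<close>, written as a difference quotient of an
  antiderivative \<open>P\<close> of \<open>g\<close>. By the mean value theorem its increments are increments of \<open>g\<close> over the same
  distance, so the Hoelder constant does not grow.\<close>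

lemma holder_mollification:
  assumes g: "holder_bound \<gamma> G UNIV g" and \<gamma>: "0 < \<gamma>" and G: "0 \<le> G" and \<epsilon>: "0 < \<epsilon>"
  obtains k k' where "continuous_on {0..T} k'"
    and "\<And>t. t \<in> {0..T} \<Longrightarrow> (k has_real_derivative k' t) (at t within {0..T})"
    and "holder_bound \<gamma> G {0..T} k"
    and "\<And>t. t \<in> {0..T} \<Longrightarrow> \<bar>k t - g t\<bar> \<le> G * \<epsilon> powr \<gamma>"
proof -
  have cont: "continuous_on S g" for S
    using holder_bound_continuous_on[OF g \<gamma>] continuous_on_subset by blast
  obtain P where P0: "\<And>t. t \<in> {-1..T + \<epsilon> + 1} \<Longrightarrow>
      (P has_vector_derivative g t) (at t within {-1..T + \<epsilon> + 1})"
    using antiderivative_continuous[OF cont] by blast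
  have P: "(P has_real_derivative g t) (at t)" if "0 \<le> t" "t \<le> T + \<epsilon>" for t
    using P0[of t] that at_within_interior[of t "{-1..T + \<epsilon> + 1}"]
    by (auto simp: has_real_derivative_iff_has_vector_derivative)
  define k where "k t = (P (t + \<epsilon>) - P t) / \<epsilon>" for t
  define k' where "k' t = (g (t + \<epsilon>) - g t) / \<epsilon>" for t
  have shift: "continuous_on {0..T} (\<lambda>t. g (t + \<epsilon>))"
    by (intro continuous_on_compose2[OF cont[of UNIV]] continuous_intros) auto
  have "continuous_on {0..T} k'"
    unfolding k'_def using \<epsilon> by (intro continuous_intros shift cont) auto
  moreover have "(k has_real_derivative k' t) (at t within {0..T})" if "t \<in> {0..T}" for t
  proof -
    have "((\<lambda>t. P (t + \<epsilon>)) has_real_derivative g (t + \<epsilon>)) (at t)"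
      using that \<epsilon> by (subst DERIV_shift[symmetric]) (auto intro: P)
    then have "(k has_real_derivative k' t) (at t)"
      unfolding k_def k'_def using that \<epsilon> by (intro DERIV_cdivide DERIV_diff P) auto
    then show ?thesis by (rule has_field_derivative_at_within)
  qed
  moreover have "holder_bound \<gamma> G {0..T} k"
    unfolding holder_bound_def
  proof (intro ballI impI)
    fix s t assume st: "s \<in> {0..T}" "t \<in> {0..T}" "s \<le> t"
    have "\<exists>z>0. z < \<epsilon> \<and> (P (t + \<epsilon>) - P (s + \<epsilon>)) - (P (t + 0) - P (s + 0)) = (\<epsilon> - 0) * (g (t + z) - g (s + z))"
    proof (rule MVT2[OF \<epsilon>])
      fix z assume "0 \<le> z" "z \<le> \<epsilon>"
      then have "((\<lambda>z. P (z + t)) has_real_derivative g (z + t)) (at z)"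
        "((\<lambda>z. P (z + s)) has_real_derivative g (z + s)) (at z)"
        using st by (subst DERIV_shift[symmetric]; auto intro: P)+
      then show "((\<lambda>z. P (t + z) - P (s + z)) has_real_derivative g (t + z) - g (s + z)) (at z)"
        by (intro DERIV_diff) (simp_all add: add.commute)
    qed
    then obtain z where "(P (t + \<epsilon>) - P (s + \<epsilon>)) - (P t - P s) = \<epsilon> * (g (t + z) - g (s + z))"
      by auto
    then have "(P (t + \<epsilon>) - P t) - (P (s + \<epsilon>) - P s) = \<epsilon> * (g (t + z) - g (s + z))"
      by (simp only: algebra_simps)
    then have "k t - k s = g (t + z) - g (s + z)"
      using \<epsilon> unfolding k_def diff_divide_distrib[symmetric] by simp
    then show "\<bar>k t - k s\<bar> \<le> G * (t - s) powr \<gamma>"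
      using holder_boundD[OF g, of "s + z" "t + z"] st by auto
  qed
  moreover have "\<bar>k t - g t\<bar> \<le> G * \<epsilon> powr \<gamma>" if "t \<in> {0..T}" for t
  proof -
    have "\<exists>z>t. z < t + \<epsilon> \<and> P (t + \<epsilon>) - P t = (t + \<epsilon> - t) * g z"
      using that \<epsilon> by (intro MVT2 P) auto
    then obtain z where z: "t < z" "z < t + \<epsilon>" "k t = g z"
      using \<epsilon> by (auto simp: k_def)
    have "\<bar>g z - g t\<bar> \<le> G * (z - t) powr \<gamma>" using z by (intro holder_boundD[OF g]) auto
    also have "\<dots> \<le> G * \<epsilon> powr \<gamma>" using z \<gamma> G by (intro mult_left_mono powr_mono2) auto
    finally show ?thesis by (simp add: z)
  qed
  ultimately show ?thesis by (rule that)
qed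

text \<open>A function that is small uniformly but only bounded in the \<open>\<gamma>\<close>-Hoelder sense is small in the
  \<open>\<gamma>'\<close>-Hoelder sense for \<open>\<gamma>' < \<gamma>\<close>: use the Hoelder bound up to distance \<open>\<epsilon>\<close> and the uniform bound beyond.
  Applied to differences of mollifications, it makes their primitives a Cauchy sequence.\<close>

lemma holder_bound_interpolate:
  assumes d: "holder_bound \<gamma> (2 * G) {0..T} d" and small: "\<And>t. t \<in> {0..T} \<Longrightarrow> \<bar>d t\<bar> \<le> 2 * G * \<epsilon> powr \<gamma>"
    and \<gamma>: "0 \<le> \<gamma>'" "\<gamma>' \<le> \<gamma>" and G: "0 \<le> G" and \<epsilon>: "0 < \<epsilon>"
  shows "holder_bound \<gamma>' (4 * G * \<epsilon> powr (\<gamma> - \<gamma>')) {0..T} d"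
  unfolding holder_bound_def
proof (intro ballI impI)
  fix s t assume st: "s \<in> {0..T}" "t \<in> {0..T}" "s \<le> t"
  show "\<bar>d t - d s\<bar> \<le> 4 * G * \<epsilon> powr (\<gamma> - \<gamma>') * (t - s) powr \<gamma>'"
  proof (cases "t - s \<le> \<epsilon>")
    case True
    have "\<bar>d t - d s\<bar> \<le> 2 * G * (t - s) powr \<gamma>" using st by (intro holder_boundD[OF d]) auto
    also have "\<dots> = 2 * G * ((t - s) powr (\<gamma> - \<gamma>') * (t - s) powr \<gamma>')"
      by (simp flip: powr_add)
    also have "\<dots> \<le> 4 * G * (\<epsilon> powr (\<gamma> - \<gamma>') * (t - s) powr \<gamma>')"
      using st True \<gamma> G by (intro mult_mono powr_mono2) auto
    finally show ?thesis by (simp add: mult.assoc)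
  next
    case False
    have "\<bar>d t - d s\<bar> \<le> 2 * G * \<epsilon> powr \<gamma> + 2 * G * \<epsilon> powr \<gamma>"
      using small[OF st(1)] small[OF st(2)] by linarith
    also have "\<dots> = 4 * G * (\<epsilon> powr (\<gamma> - \<gamma>') * \<epsilon> powr \<gamma>')"
      by (simp flip: powr_add)
    also have "\<dots> \<le> 4 * G * (\<epsilon> powr (\<gamma> - \<gamma>') * (t - s) powr \<gamma>')"
      using st False \<gamma> G \<epsilon> by (intro mult_left_mono powr_mono2) auto
    finally show ?thesis by (simp add: mult.assoc)
  qed
qed

lemma convergent_by_tail_bound:
  fixes X :: "nat \<Rightarrow> real"
  assumes "\<And>m n. n \<le> m \<Longrightarrow> \<bar>X m - X n\<bar> \<le> e n" and "e \<longlonglongrightarrow> 0"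
  shows "convergent X"
proof -
  have "Cauchy X"
  proof (rule metric_CauchyI)
    fix r :: real assume "0 < r"
    then have "eventually (\<lambda>n. e n < r / 2) sequentially"
      using order_tendstoD(2)[OF assms(2), of "r / 2"] by simp
    then obtain N where N: "e N < r / 2" by (auto simp: eventually_sequentially)
    have "dist (X m) (X n) < r" if "N \<le> m" "N \<le> n" for m n
      using assms(1)[OF that(1)] assms(1)[OF that(2)] N unfolding dist_real_def by linarith
    then show "\<exists>M. \<forall>m\<ge>M. \<forall>n\<ge>M. dist (X m) (X n) < r" by blast
  qed
  then show ?thesis by (rule Cauchy_convergent)
qed

lemma young_primitive_exists:
  assumes f: "holder_bound \<beta> A {0..T} f" and g: "holder_bound \<gamma> G UNIV g"
    and \<beta>: "0 < \<beta>" "\<beta> \<le> 1" and \<gamma>: "0 < \<gamma>" "\<gamma> \<le> 1" and \<theta>: "1 < \<beta> + \<gamma>" and AG: "0 \<le> A" "0 \<le> G" and T: "0 < T"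
  shows "\<exists>F. young_primitive (\<beta> + \<gamma>) T f g F"
proof -
  define \<epsilon> where "\<epsilon> n = inverse (real (Suc n))" for n
  have \<epsilon>: "0 < \<epsilon> n" "n \<le> m \<Longrightarrow> \<epsilon> m \<le> \<epsilon> n" for n m by (auto simp: \<epsilon>_def field_simps)
  have \<epsilon>_powr: "(\<lambda>n. \<epsilon> n powr c) \<longlonglongrightarrow> 0" if "0 < c" for c
    unfolding \<epsilon>_def by (rule tendsto_zero_powrI[OF LIMSEQ_inverse_real_of_nat tendsto_const]) (use that in auto)
  have "\<forall>n. \<exists>k k'. continuous_on {0..T} k' \<and>
    (\<forall>t\<in>{0..T}. (k has_real_derivative k' t) (at t within {0..T})) \<and>
    holder_bound \<gamma> G {0..T} k \<and> (\<forall>t\<in>{0..T}. \<bar>k t - g t\<bar> \<le> G * \<epsilon> n powr \<gamma>)"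
    by (intro allI, rule holder_mollification[OF g \<gamma>(1) AG(2) \<epsilon>(1), where T = T]) blast
  then obtain k k' where k: "\<And>n. continuous_on {0..T} (k' n)"
      "\<And>n t. t \<in> {0..T} \<Longrightarrow> (k n has_real_derivative k' n t) (at t within {0..T})"
      "\<And>n. holder_bound \<gamma> G {0..T} (k n)" "\<And>n t. t \<in> {0..T} \<Longrightarrow> \<bar>k n t - g t\<bar> \<le> G * \<epsilon> n powr \<gamma>"
    by metis
  define F where "F n t = integral {0..t} (\<lambda>\<tau>. f \<tau> * k' n \<tau>)" for n t
  have F: "young_primitive \<theta> T f (k n) (F n)" if "\<theta> \<le> 1 + \<beta>" for n \<theta>
    unfolding F_def using young_primitive_smooth[OF f \<beta>(1) that AG(1) k(2,1) T] .
  (* The sum \<beta> + \<gamma>' is the midpoint between 1 and \<beta> + \<gamma>, so part of the exponent can be given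
     up for smallness while the sum stays above 1. *)
  define \<gamma>' where "\<gamma>' = (1 + \<gamma> - \<beta>) / 2"
  have \<gamma>': "0 < \<gamma>'" "\<gamma>' < \<gamma>" "1 < \<beta> + \<gamma>'"
    using \<theta> \<gamma> \<beta> by (simp_all add: \<gamma>'_def field_simps)
  have tail: "\<bar>(F m t - F n t) - f 0 * ((k m t - k n t) - (k m 0 - k n 0))\<bar>
      \<le> A * (4 * G * \<epsilon> n powr (\<gamma> - \<gamma>')) / (1 - 2 powr (1 - (\<beta> + \<gamma>'))) * t powr (\<beta> + \<gamma>')"
    if nm: "n \<le> m" and t: "t \<in> {0..T}" for m n t
  proof -
    have small: "\<bar>k m t - k n t\<bar> \<le> 2 * G * \<epsilon> n powr \<gamma>" if "t \<in> {0..T}" for t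
    proof -
      have "G * \<epsilon> m powr \<gamma> \<le> G * \<epsilon> n powr \<gamma>"
        using AG \<gamma> \<epsilon>(1)[of m] \<epsilon>(2)[OF nm] by (intro mult_left_mono powr_mono2) auto
      then show ?thesis using k(4)[OF that, of m] k(4)[OF that, of n] by linarith
    qed
    have hold: "holder_bound \<gamma> (2 * G) {0..T} (\<lambda>t. k m t - k n t)"
      by (intro holder_bound_diff k(3))
    have "young_primitive (\<beta> + \<gamma>') T f (\<lambda>t. k m t - k n t) (\<lambda>t. F m t - F n t)"
      using \<gamma>' \<gamma> by (intro young_primitive_diff_integrator F) auto
    moreover have "holder_bound \<gamma>' (4 * G * \<epsilon> n powr (\<gamma> - \<gamma>')) {0..T} (\<lambda>t. k m t - k n t)"
      using \<gamma>' AG \<epsilon>(1) by (intro holder_bound_interpolate[OF hold small]) auto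
    then have "holder_bound \<gamma>' (4 * G * \<epsilon> n powr (\<gamma> - \<gamma>')) {0..t} (\<lambda>t. k m t - k n t)"
      by (rule holder_bound_subset) (use t in auto)
    ultimately have "\<bar>(F m t - F n t) - (F m 0 - F n 0) - f 0 * ((k m t - k n t) - (k m 0 - k n 0))\<bar>
      \<le> A * (4 * G * \<epsilon> n powr (\<gamma> - \<gamma>')) / (1 - 2 powr (1 - (\<beta> + \<gamma>'))) * (t - 0) powr (\<beta> + \<gamma>')"
      using t \<gamma>' \<beta> AG
      by (intro young_primitive_bound[where T = T and s = 0] holder_bound_subset[OF f]) auto
    then show ?thesis by (simp add: F_def)
  qed
  have g_lim: "(\<lambda>n. k n t) \<longlonglongrightarrow> g t" if "t \<in> {0..T}" for t
  proof -
    have "(\<lambda>n. G * \<epsilon> n powr \<gamma>) \<longlonglongrightarrow> 0" by (intro tendsto_mult_right_zero \<epsilon>_powr \<gamma>)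
    then have "(\<lambda>n. k n t - g t) \<longlonglongrightarrow> 0"
      by (rule Lim_null_comparison[rotated]) (use k(4)[OF that] in auto)
    then show ?thesis by (rule Lim_null[THEN iffD2])
  qed
  have conv: "convergent (\<lambda>n. F n t)" if t: "t \<in> {0..T}" for t
  proof -
    let ?c = "1 / (1 - 2 powr (1 - (\<beta> + \<gamma>'))) * t powr (\<beta> + \<gamma>')"
    define Y where "Y n = F n t - f 0 * (k n t - k n 0)" for n
    have "convergent Y"
    proof (rule convergent_by_tail_bound)
      show "\<bar>Y m - Y n\<bar> \<le> A * (4 * G * \<epsilon> n powr (\<gamma> - \<gamma>')) * ?c" if "n \<le> m" for m n
        using tail[OF that t] by (simp add: Y_def algebra_simps)
      have "(\<lambda>n. A * (4 * G * \<epsilon> n powr (\<gamma> - \<gamma>')) * ?c) \<longlonglongrightarrow> A * (4 * G * 0) * ?c"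
        using \<gamma>' by (intro tendsto_mult tendsto_const \<epsilon>_powr) auto
      then show "(\<lambda>n. A * (4 * G * \<epsilon> n powr (\<gamma> - \<gamma>')) * ?c) \<longlonglongrightarrow> 0" by simp
    qed
    moreover have "convergent (\<lambda>n. f 0 * (k n t - k n 0))"
      using g_lim[OF t] g_lim[of 0] T
      by (intro convergentI[where L = "f 0 * (g t - g 0)"] tendsto_intros) auto
    ultimately have "convergent (\<lambda>n. Y n + f 0 * (k n t - k n 0))" by (rule convergent_add)
    then show ?thesis by (simp add: Y_def)
  qed
  (* The limit inherits the remainder bound, whose constant is the same for all mollifications. *)
  define F' where "F' t = lim (\<lambda>n. F n t)" for t
  have F': "(\<lambda>n. F n t) \<longlonglongrightarrow> F' t" if "t \<in> {0..T}" for t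
    using conv[OF that] by (simp add: F'_def convergent_LIMSEQ_iff)
  have "\<bar>F' t - F' s - f s * (g t - g s)\<bar> \<le> A * G / (1 - 2 powr (1 - (\<beta> + \<gamma>))) * (t - s) powr (\<beta> + \<gamma>)"
    if st: "0 \<le> s \<and> s \<le> t \<and> t \<le> T" for s t
  proof (rule LIMSEQ_le_const2)
    show "(\<lambda>n. \<bar>F n t - F n s - f s * (k n t - k n s)\<bar>) \<longlonglongrightarrow> \<bar>F' t - F' s - f s * (g t - g s)\<bar>"
      using st by (intro tendsto_intros F' g_lim) auto
    have "\<bar>F n t - F n s - f s * (k n t - k n s)\<bar> \<le> A * G / (1 - 2 powr (1 - (\<beta> + \<gamma>))) * (t - s) powr (\<beta> + \<gamma>)" for n
      using st \<theta> \<beta> \<gamma> AG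
      by (intro young_primitive_bound[OF F] holder_bound_subset[OF f] holder_bound_subset[OF k(3)]) auto
    then show "\<exists>N. \<forall>n\<ge>N. \<bar>F n t - F n s - f s * (k n t - k n s)\<bar> \<le> A * G / (1 - 2 powr (1 - (\<beta> + \<gamma>))) * (t - s) powr (\<beta> + \<gamma>)"
      by blast
  qed
  moreover have "F' 0 = 0" by (simp add: F'_def F_def)
  ultimately show ?thesis unfolding young_primitive_def by blast
qed

section \<open>Young primitives and Riemann-Stieltjes sums\<close>

lemma has_stieltjes_integral_unique:
  assumes "has_stieltjes_integral f g a b J" "has_stieltjes_integral f g a b J'"
  shows "J = J'"
proof (rule ccontr)
  assume "J \<noteq> J'"
  define \<epsilon> where "\<epsilon> = \<bar>J - J'\<bar> / 2"
  have \<epsilon>: "0 < \<epsilon>" using \<open>J \<noteq> J'\<close> by (simp add: \<epsilon>_def)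
  obtain \<delta> where \<delta>: "0 < \<delta>" "\<forall>p. p tagged_division_of {a..b} \<and> (\<forall>(\<xi>, K)\<in>p. Sup K - Inf K < \<delta>) \<longrightarrow>
      \<bar>stieltjes_sum f g p - J\<bar> < \<epsilon>"
    using assms(1)[unfolded has_stieltjes_integral_def, THEN spec, THEN mp, OF \<epsilon>] by (elim exE conjE)
  obtain \<delta>' where \<delta>': "0 < \<delta>'" "\<forall>p. p tagged_division_of {a..b} \<and> (\<forall>(\<xi>, K)\<in>p. Sup K - Inf K < \<delta>') \<longrightarrow>
      \<bar>stieltjes_sum f g p - J'\<bar> < \<epsilon>"
    using assms(2)[unfolded has_stieltjes_integral_def, THEN spec, THEN mp, OF \<epsilon>] by (elim exE conjE)
  define r where "r = min \<delta> \<delta>' / 2"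
  have "gauge (\<lambda>x::real. ball x r)" using \<delta>(1) \<delta>'(1) by (intro gauge_ball) (simp add: r_def)
  then obtain p where p: "p tagged_division_of {a..b}" "(\<lambda>x. ball x r) fine p"
    using fine_division_exists_real by blast
  have mesh: "Sup K - Inf K < 2 * r" if cell: "(\<xi>, K) \<in> p" for \<xi> K
  proof -
    obtain u v where K: "K = {u..v}" "u \<le> \<xi>" "\<xi> \<le> v"
      using tagged_division_ofD(2,4)[OF p(1) cell] by auto
    have "K \<subseteq> ball \<xi> r" using p(2) cell unfolding fine_def by blast
    then have "u \<in> ball \<xi> r" "v \<in> ball \<xi> r" using K by (auto simp del: mem_ball)
    then show ?thesis using K unfolding mem_ball dist_real_def by simp
  qed
  have "2 * r \<le> \<delta>" "2 * r \<le> \<delta>'" by (auto simp: r_def)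
  then have "\<forall>(\<xi>, K)\<in>p. Sup K - Inf K < \<delta>" "\<forall>(\<xi>, K)\<in>p. Sup K - Inf K < \<delta>'"
    using mesh by (blast intro: less_le_trans)+
  then have "\<bar>stieltjes_sum f g p - J\<bar> < \<epsilon>" "\<bar>stieltjes_sum f g p - J'\<bar> < \<epsilon>"
    using p(1) \<delta>(2)[THEN spec, of p] \<delta>'(2)[THEN spec, of p] by simp_all
  moreover have "\<bar>J - J'\<bar> \<le> \<bar>stieltjes_sum f g p - J\<bar> + \<bar>stieltjes_sum f g p - J'\<bar>" by linarith
  ultimately show False by (simp add: \<epsilon>_def)
qed

text \<open>On a cell of length \<open>l < \<delta>\<close> the Riemann sum and the increment of \<open>F\<close> differ by at most a constant times
  \<open>l\<^sup>\<theta>\<close>, wherever the tag lies, and \<open>l\<^sup>\<theta>\<close> is at most \<open>\<delta>\<^sup>\<theta>\<^sup>-\<^sup>1 * l\<close>. Both the lengths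
  and the increments of \<open>F\<close> add up over a tagged division, so the cells need not be ordered.\<close>

lemma young_primitive_has_stieltjes_integral:
  assumes F: "young_primitive (\<beta> + \<gamma>) T f g F" and \<theta>: "1 < \<beta> + \<gamma>" "0 \<le> \<beta>" "0 \<le> \<gamma>"
    and f: "holder_bound \<beta> A {0..T} f" and g: "holder_bound \<gamma> G {0..T} g" and AG: "0 \<le> A" "0 \<le> G"
    and t: "t \<in> {0..T}"
  shows "has_stieltjes_integral f g 0 t (F t)"
  unfolding has_stieltjes_integral_def
proof (intro allI impI)
  fix \<epsilon> :: real assume \<epsilon>: "0 < \<epsilon>"
  obtain C where
    C: "\<And>s t. 0 \<le> s \<and> s \<le> t \<and> t \<le> T \<Longrightarrow> \<bar>F t - F s - f s * (g t - g s)\<bar> \<le> C * (t - s) powr (\<beta> + \<gamma>)"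
    using F unfolding young_primitive_def by blast
  define N where "N = \<bar>C\<bar> + A * G"
  have N: "0 \<le> N" using AG by (simp add: N_def)
  have cell: "\<bar>f \<xi> * (g v - g u) - (F v - F u)\<bar> \<le> N * (v - u) powr (\<beta> + \<gamma>)"
    if "0 \<le> u" "u \<le> \<xi>" "\<xi> \<le> v" "v \<le> T" for \<xi> u v
  proof -
    have "\<bar>(f \<xi> - f u) * (g v - g u)\<bar> \<le> (A * (\<xi> - u) powr \<beta>) * (G * (v - u) powr \<gamma>)"
      unfolding abs_mult using that AG by (intro mult_mono holder_boundD[OF f] holder_boundD[OF g]) auto
    also have "\<dots> \<le> (A * (v - u) powr \<beta>) * (G * (v - u) powr \<gamma>)"
      using that AG \<theta> by (intro mult_mono powr_mono2) auto
    finally have "\<bar>(f \<xi> - f u) * (g v - g u)\<bar> \<le> A * G * (v - u) powr (\<beta> + \<gamma>)"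
      by (simp add: powr_add mult_ac)
    moreover have "\<bar>F v - F u - f u * (g v - g u)\<bar> \<le> \<bar>C\<bar> * (v - u) powr (\<beta> + \<gamma>)"
      using C[of u v] that by (smt (verit) mult_right_mono powr_ge_zero)
    moreover have "f \<xi> * (g v - g u) - (F v - F u)
        = (f \<xi> - f u) * (g v - g u) - (F v - F u - f u * (g v - g u))"
      by (simp add: algebra_simps)
    ultimately show ?thesis unfolding N_def distrib_right by linarith
  qed
  (* Chosen so that N * \<delta> powr (\<beta> + \<gamma> - 1) * t < \<epsilon>; the summand 1 covers the case N * t = 0. *)
  define \<delta> where "\<delta> = (\<epsilon> / (N * t + 1)) powr (1 / (\<beta> + \<gamma> - 1))"
  have Nt: "0 \<le> N * t" using N t by simp
  have "0 < \<delta>" using \<epsilon> Nt by (simp add: \<delta>_def)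
  have \<delta>: "\<delta> powr (\<beta> + \<gamma> - 1) = \<epsilon> / (N * t + 1)"
    using \<theta> \<epsilon> Nt by (simp add: \<delta>_def powr_powr)
  have "\<bar>stieltjes_sum f g p - F t\<bar> < \<epsilon>"
    if p: "p tagged_division_of {0..t}" and mesh: "\<forall>(\<xi>, K)\<in>p. Sup K - Inf K < \<delta>" for p
  proof -
    have "F t = (\<Sum>(\<xi>, K)\<in>p. F (Sup K) - F (Inf K))"
      using additive_tagged_division_1[OF _ p, of F] t F by (simp add: young_primitive_def)
    then have "stieltjes_sum f g p - F t
        = (\<Sum>(\<xi>, K)\<in>p. f \<xi> * (g (Sup K) - g (Inf K)) - (F (Sup K) - F (Inf K)))"
      unfolding stieltjes_sum_def by (simp add: sum_subtractf case_prod_beta)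
    also have "\<bar>\<dots>\<bar> \<le> (\<Sum>(\<xi>, K)\<in>p. N * \<delta> powr (\<beta> + \<gamma> - 1) * (Sup K - Inf K))"
    proof (rule order.trans[OF sum_abs], rule sum_mono, clarify)
      fix \<xi> K assume K: "(\<xi>, K) \<in> p"
      obtain u v where uv: "K = {u..v}" "u \<le> \<xi>" "\<xi> \<le> v" "0 \<le> u" "v \<le> t"
        using tagged_division_ofD(2,3,4)[OF p K] by (metis atLeastAtMost_iff atLeastatMost_subset_iff cbox_interval order.trans)
      have "v - u < \<delta>" using mesh K uv by fastforce
      have "\<bar>f \<xi> * (g v - g u) - (F v - F u)\<bar> \<le> N * (v - u) powr (\<beta> + \<gamma>)"
        using uv t by (intro cell) auto
      also have "\<dots> = N * (v - u) powr (\<beta> + \<gamma> - 1) * (v - u)"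
        using uv powr_add[of "v - u" "\<beta> + \<gamma> - 1" 1] by simp
      also have "\<dots> \<le> N * \<delta> powr (\<beta> + \<gamma> - 1) * (v - u)"
        using uv N \<theta> \<open>v - u < \<delta>\<close> by (intro mult_right_mono mult_left_mono powr_mono2) auto
      finally show "\<bar>f \<xi> * (g (Sup K) - g (Inf K)) - (F (Sup K) - F (Inf K))\<bar>
          \<le> N * \<delta> powr (\<beta> + \<gamma> - 1) * (Sup K - Inf K)"
        using uv by simp
    qed
    also have "\<dots> = N * \<delta> powr (\<beta> + \<gamma> - 1) * (\<Sum>(\<xi>, K)\<in>p. Sup K - Inf K)"
      by (simp add: sum_distrib_left case_prod_beta)
    also have "(\<Sum>(\<xi>, K)\<in>p. Sup K - Inf K) = t"
      using additive_tagged_division_1[OF _ p, of "\<lambda>x. x"] t by simp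
    also have "N * \<delta> powr (\<beta> + \<gamma> - 1) * t < \<epsilon>"
      unfolding \<delta> using Nt \<epsilon> by (simp add: field_simps)
    finally show ?thesis .
  qed
  then show "\<exists>\<delta>>0. \<forall>p. p tagged_division_of {0..t} \<and> (\<forall>(\<xi>, K)\<in>p. Sup K - Inf K < \<delta>) \<longrightarrow>
      \<bar>stieltjes_sum f g p - F t\<bar> < \<epsilon>"
    using \<open>0 < \<delta>\<close> by blast
qed

section \<open>Increments over short distances with an exponential weight\<close>

text \<open>A Bielecki-type seminorm bound. The restriction to distances up to \<open>h\<close> makes powers of \<open>t - s\<close> beyond \<open>\<beta>\<close>
  small, and the weight \<open>2 powr (t / h)\<close> doubles over such a distance.\<close>

definition weighted_holder :: "real \<Rightarrow> real \<Rightarrow> real \<Rightarrow> real \<Rightarrow> (real \<Rightarrow> real) \<Rightarrow> bool" where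
  "weighted_holder \<beta> h T M u \<longleftrightarrow> (\<forall>s t. 0 \<le> s \<and> s \<le> t \<and> t \<le> T \<and> t \<le> s + h \<longrightarrow>
     \<bar>u t - u s\<bar> \<le> M * 2 powr (t / h) * (t - s) powr \<beta>)"

lemma weighted_holderD:
  "weighted_holder \<beta> h T M u \<Longrightarrow> 0 \<le> s \<Longrightarrow> s \<le> t \<Longrightarrow> t \<le> T \<Longrightarrow> t \<le> s + h \<Longrightarrow>
    \<bar>u t - u s\<bar> \<le> M * 2 powr (t / h) * (t - s) powr \<beta>"
  unfolding weighted_holder_def by blast

lemma weighted_holder_add:
  assumes "weighted_holder \<beta> h T M u" "weighted_holder \<beta> h T N v"
  shows "weighted_holder \<beta> h T (M + N) (\<lambda>t. u t + v t)"
  unfolding weighted_holder_def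
proof (intro allI impI, elim conjE)
  fix s t assume st: "0 \<le> s" "s \<le> t" "t \<le> T" "t \<le> s + h"
  show "\<bar>u t + v t - (u s + v s)\<bar> \<le> (M + N) * 2 powr (t / h) * (t - s) powr \<beta>"
    using weighted_holderD[OF assms(1) st] weighted_holderD[OF assms(2) st]
    unfolding distrib_right by linarith
qed

lemma weighted_holder_mono:
  assumes "weighted_holder \<beta> h T M u" "M \<le> N"
  shows "weighted_holder \<beta> h T N u"
  unfolding weighted_holder_def
proof (intro allI impI, elim conjE)
  fix s t assume st: "0 \<le> s" "s \<le> t" "t \<le> T" "t \<le> s + h"
  have "M * 2 powr (t / h) * (t - s) powr \<beta> \<le> N * 2 powr (t / h) * (t - s) powr \<beta>"
    using assms(2) by (intro mult_right_mono) auto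
  then show "\<bar>u t - u s\<bar> \<le> N * 2 powr (t / h) * (t - s) powr \<beta>"
    using weighted_holderD[OF assms(1) st] by linarith
qed

lemma weighted_holder_limit:
  assumes "\<And>n::nat. N \<le> n \<Longrightarrow> weighted_holder \<beta> h T M (U n)"
    and lim: "\<And>t. t \<in> {0..T} \<Longrightarrow> (\<lambda>n. U n t) \<longlonglongrightarrow> u t"
  shows "weighted_holder \<beta> h T M u"
  unfolding weighted_holder_def
proof (intro allI impI, elim conjE)
  fix s t assume st: "0 \<le> s" "s \<le> t" "t \<le> T" "t \<le> s + h"
  show "\<bar>u t - u s\<bar> \<le> M * 2 powr (t / h) * (t - s) powr \<beta>"
  proof (rule LIMSEQ_le_const2)
    show "(\<lambda>n. \<bar>U n t - U n s\<bar>) \<longlonglongrightarrow> \<bar>u t - u s\<bar>"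
      using st by (intro tendsto_intros lim) auto
    show "\<exists>N. \<forall>n\<ge>N. \<bar>U n t - U n s\<bar> \<le> M * 2 powr (t / h) * (t - s) powr \<beta>"
      using weighted_holderD[OF assms(1) st] by blast
  qed
qed

lemma weighted_holder_of_holder_bound:
  assumes u: "holder_bound \<beta> A {0..T} u" and A: "0 \<le> A" and h: "0 < h"
  shows "weighted_holder \<beta> h T A u"
  unfolding weighted_holder_def
proof (intro allI impI, elim conjE)
  fix s t assume st: "0 \<le> s" "s \<le> t" "t \<le> T" "t \<le> s + h"
  have "\<bar>u t - u s\<bar> \<le> A * 1 * (t - s) powr \<beta>" using holder_boundD[OF u, of s t] st by simp
  also have "\<dots> \<le> A * 2 powr (t / h) * (t - s) powr \<beta>"
    using A h st by (intro mult_right_mono mult_left_mono ge_one_powr_ge_zero) auto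
  finally show "\<bar>u t - u s\<bar> \<le> A * 2 powr (t / h) * (t - s) powr \<beta>" .
qed

lemma weight_mono: "0 < h \<Longrightarrow> r \<le> t \<Longrightarrow> 2 powr (r / h) \<le> 2 powr (t / h)" for h r t :: real
  by (intro powr_mono divide_right_mono) auto

lemma weighted_holder_imp_holder_bound_short:
  assumes u: "weighted_holder \<beta> h T M u" and "0 \<le> M" "0 < h" "0 \<le> s" "t \<le> T" "t \<le> s + h"
  shows "holder_bound \<beta> (M * 2 powr (t / h)) {s..t} u"
  unfolding holder_bound_def
proof (intro ballI impI)
  fix r q assume rq: "r \<in> {s..t}" "q \<in> {s..t}" "r \<le> q"
  have "\<bar>u q - u r\<bar> \<le> M * 2 powr (q / h) * (q - r) powr \<beta>"
    using rq assms by (intro weighted_holderD[OF u]) auto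
  also have "\<dots> \<le> M * 2 powr (t / h) * (q - r) powr \<beta>"
    using rq assms by (intro mult_right_mono mult_left_mono weight_mono) auto
  finally show "\<bar>u q - u r\<bar> \<le> M * 2 powr (t / h) * (q - r) powr \<beta>" .
qed

text \<open>Walking back from \<open>t\<close> to \<open>0\<close> in steps of length \<open>h\<close>, the weight halves each time, so the bounds on the increments
  sum to at most twice the last one. The factor \<open>h powr \<beta>\<close> shows that, for functions vanishing at \<open>0\<close>, values are
  smaller than increments.\<close>

lemma weighted_holder_sup_bound:
  assumes u: "weighted_holder \<beta> h T M u" and u0: "u 0 = 0" and M: "0 \<le> M" and h: "0 < h"
    and \<beta>: "0 \<le> \<beta>" and t: "t \<in> {0..T}"
  shows "\<bar>u t\<bar> \<le> 2 * M * h powr \<beta> * 2 powr (t / h)"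
proof -
  have *: "\<bar>u t\<bar> \<le> 2 * M * h powr \<beta> * 2 powr (t / h)"
    if "t \<in> {0..T}" "t \<le> real n * h" for n t
    using that
  proof (induction n arbitrary: t)
    case 0
    then show ?case using u0 M by simp
  next
    case (Suc n)
    define w where "w = 2 powr (t / h)"
    define m where "m = max 0 (t - h)"
    have m: "0 \<le> m" "m \<le> t" "t - m \<le> h" "m \<in> {0..T}" using Suc.prems(1) h by (auto simp: m_def)
    have "\<bar>u t - u m\<bar> \<le> M * w * (t - m) powr \<beta>"
      unfolding w_def using m Suc.prems by (intro weighted_holderD[OF u]) auto
    also have "\<dots> \<le> M * w * h powr \<beta>"
      using m M \<beta> by (intro mult_left_mono powr_mono2) (auto simp: w_def)
    finally have step: "\<bar>u t - u m\<bar> \<le> M * h powr \<beta> * w" by (simp only: mult_ac)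
    have "\<bar>u m\<bar> \<le> M * h powr \<beta> * w"
    proof (cases "t \<le> h")
      case True
      then show ?thesis using u0 M by (simp add: m_def w_def)
    next
      case False
      have "m \<le> real n * h" using False Suc.prems(2) by (simp add: m_def algebra_simps)
      then have "\<bar>u m\<bar> \<le> 2 * M * h powr \<beta> * 2 powr (m / h)" by (intro Suc.IH m)
      also have "2 powr (m / h) = w / 2"
        using False h by (simp add: m_def w_def diff_divide_distrib powr_diff)
      finally show ?thesis by simp
    qed
    then show ?case using step unfolding w_def by linarith
  qed
  obtain n :: nat where "t / h \<le> real n" using real_arch_simple by blast
  then show ?thesis using * t h by (simp add: field_simps)
qed

lemma weighted_holder_imp_holder_bound:
  assumes u: "weighted_holder \<beta> h T M u" and M: "0 \<le> M" and h: "0 < h" and \<beta>: "0 \<le> \<beta>"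
  shows "holder_bound \<beta> (4 * M * 2 powr (T / h)) {0..T} u"
  unfolding holder_bound_def
proof (intro ballI impI)
  fix s t assume st: "s \<in> {0..T}" "t \<in> {0..T}" "s \<le> t"
  let ?W = "2 powr (T / h)"
  show "\<bar>u t - u s\<bar> \<le> 4 * M * ?W * (t - s) powr \<beta>"
  proof (cases "t \<le> s + h")
    case True
    have "\<bar>u t - u s\<bar> \<le> M * 2 powr (t / h) * (t - s) powr \<beta>"
      using st True by (intro weighted_holderD[OF u]) auto
    also have "\<dots> \<le> (4 * M) * ?W * (t - s) powr \<beta>"
      using st M h by (intro mult_right_mono mult_mono weight_mono) auto
    finally show ?thesis .
  next
    case False
    have v: "weighted_holder \<beta> h T M (\<lambda>t. u t - u 0)"
      using u by (simp add: weighted_holder_def)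
    have sup: "\<bar>u r - u 0\<bar> \<le> 2 * M * h powr \<beta> * ?W" if "r \<in> {0..T}" for r
    proof -
      have "\<bar>u r - u 0\<bar> \<le> 2 * M * h powr \<beta> * 2 powr (r / h)"
        using weighted_holder_sup_bound[OF v _ M h \<beta> that] by simp
      also have "\<dots> \<le> 2 * M * h powr \<beta> * ?W"
        using that M h by (intro mult_left_mono weight_mono) auto
      finally show ?thesis .
    qed
    have "\<bar>u t - u s\<bar> \<le> 2 * M * h powr \<beta> * ?W + 2 * M * h powr \<beta> * ?W"
      using sup[OF st(1)] sup[OF st(2)] by linarith
    also have "\<dots> = 4 * M * ?W * h powr \<beta>" by (simp add: mult_ac)
    also have "\<dots> \<le> 4 * M * ?W * (t - s) powr \<beta>"
      using False M h \<beta> by (intro mult_left_mono powr_mono2) auto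
    finally show ?thesis .
  qed
qed

section \<open>The integral map\<close>

lemma DERIV_abs_le_lipschitz:
  fixes f :: "real \<Rightarrow> real"
  assumes "(f has_real_derivative D) (at x)" and "\<And>y z. \<bar>f y - f z\<bar> \<le> L * \<bar>y - z\<bar>"
  shows "\<bar>D\<bar> \<le> L"
proof (rule tendsto_upperbound)
  show "((\<lambda>h. \<bar>(f (x + h) - f x) / h\<bar>) \<longlongrightarrow> \<bar>D\<bar>) (at 0)"
    using assms(1) by (intro tendsto_rabs) (simp add: DERIV_def)
  have "\<bar>(f (x + h) - f x) / h\<bar> \<le> L" if "h \<noteq> 0" for h
    using assms(2)[of "x + h" x] that by (simp add: pos_divide_le_eq)
  then show "eventually (\<lambda>h. \<bar>(f (x + h) - f x) / h\<bar> \<le> L) (at 0)"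
    by (simp add: eventually_at_filter)
qed simp

text \<open>The Lipschitz conditions are stated with the sum of the distances in time and space, which is
  equivalent to the Euclidean distance up to the constant and keeps square roots out of the estimates.\<close>

locale young_equation =
  fixes b \<sigma> \<sigma>x :: "real \<Rightarrow> real \<Rightarrow> real" and g :: "real \<Rightarrow> real" and \<gamma> \<beta> x0 T L G :: real
  assumes \<gamma>: "\<gamma> \<le> 1" and \<beta>: "\<beta> < \<gamma>" "1 - \<gamma> < \<beta>" and T: "0 < T"
    and G: "0 \<le> G" and g: "holder_bound \<gamma> G UNIV g" and L: "0 \<le> L"
    and b_lipschitz: "\<And>s t x y. 0 \<le> s \<Longrightarrow> 0 \<le> t \<Longrightarrow> \<bar>b t x - b s y\<bar> \<le> L * (\<bar>t - s\<bar> + \<bar>x - y\<bar>)"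
    and \<sigma>_lipschitz: "\<And>s t x y. 0 \<le> s \<Longrightarrow> 0 \<le> t \<Longrightarrow> \<bar>\<sigma> t x - \<sigma> s y\<bar> \<le> L * (\<bar>t - s\<bar> + \<bar>x - y\<bar>)"
    and \<sigma>x_lipschitz: "\<And>s t x y. 0 \<le> s \<Longrightarrow> 0 \<le> t \<Longrightarrow> \<bar>\<sigma>x t x - \<sigma>x s y\<bar> \<le> L * (\<bar>t - s\<bar> + \<bar>x - y\<bar>)"
    and \<sigma>_deriv: "\<And>t x. 0 \<le> t \<Longrightarrow> ((\<lambda>y. \<sigma> t y) has_real_derivative \<sigma>x t x) (at x)"
begin

lemma exponents: "0 < \<beta>" "\<beta> < 1" "0 < \<gamma>" "1 < \<beta> + \<gamma>"
  using \<gamma> \<beta> by auto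

definition "K = G / (1 - 2 powr (1 - (\<beta> + \<gamma>)))"

lemma K_nonneg: "0 \<le> K"
  using G exponents powr_less_one[of 2 "1 - (\<beta> + \<gamma>)"] unfolding K_def by (intro divide_nonneg_nonneg) auto

text \<open>A relation rather than a function, because \<open>X\<close> is determined only on \<open>{0..T}\<close>. Solutions are exactly the
  Hoelder functions that are images of themselves.\<close>

definition integral_image :: "(real \<Rightarrow> real) \<Rightarrow> (real \<Rightarrow> real) \<Rightarrow> bool" where
  "integral_image x X \<longleftrightarrow> (\<exists>F. young_primitive (\<beta> + \<gamma>) T (\<lambda>\<tau>. \<sigma> \<tau> (x \<tau>)) g F \<and>
     (\<forall>t\<in>{0..T}. X t = x0 + integral {0..t} (\<lambda>\<tau>. b \<tau> (x \<tau>)) + F t))"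

lemma integral_image_0: "integral_image x X \<Longrightarrow> X 0 = x0"
  using T by (auto simp: integral_image_def young_primitive_def)

lemma holder_bound_along:
  assumes f: "\<And>s t x y. 0 \<le> s \<Longrightarrow> 0 \<le> t \<Longrightarrow> \<bar>f t x - f s y\<bar> \<le> L * (\<bar>t - s\<bar> + \<bar>x - y\<bar>)"
    and x: "holder_bound \<beta> A {s..t} x" and st: "0 \<le> s" "t - s \<le> D"
  shows "holder_bound \<beta> (L * (D powr (1 - \<beta>) + A)) {s..t} (\<lambda>\<tau>. f \<tau> (x \<tau>))"
  unfolding holder_bound_def
proof (intro ballI impI)
  fix r q assume rq: "r \<in> {s..t}" "q \<in> {s..t}" "r \<le> q"
  have "q - r = (q - r) powr (1 - \<beta>) * (q - r) powr \<beta>" using rq by (simp flip: powr_add)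
  also have "\<dots> \<le> D powr (1 - \<beta>) * (q - r) powr \<beta>"
    using rq st exponents by (intro mult_right_mono powr_mono2) auto
  finally have "\<bar>q - r\<bar> \<le> D powr (1 - \<beta>) * (q - r) powr \<beta>" using rq by simp
  then have "L * (\<bar>q - r\<bar> + \<bar>x q - x r\<bar>) \<le> L * (D powr (1 - \<beta>) * (q - r) powr \<beta> + A * (q - r) powr \<beta>)"
    using rq L by (intro mult_left_mono add_mono holder_boundD[OF x]) auto
  moreover have "\<bar>f q (x q) - f r (x r)\<bar> \<le> L * (\<bar>q - r\<bar> + \<bar>x q - x r\<bar>)"
    using rq st by (intro f) auto
  ultimately show "\<bar>f q (x q) - f r (x r)\<bar> \<le> L * (D powr (1 - \<beta>) + A) * (q - r) powr \<beta>"
    unfolding mult.assoc distrib_right by linarith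
qed

text \<open>The mean value theorem along the two segments simultaneously turns the left-hand side into
  \<open>\<sigma>x t P * (x' - y') - \<sigma>x s Q * (x - y)\<close>, with \<open>P\<close> and \<open>Q\<close> at the same relative position. The first term
  of the bound uses that \<open>\<sigma>x\<close> is bounded, the second that it is Lipschitz.\<close>

lemma \<sigma>_four_point:
  assumes "0 \<le> s" "0 \<le> t"
  shows "\<bar>(\<sigma> t x' - \<sigma> t y') - (\<sigma> s x - \<sigma> s y)\<bar>
    \<le> L * \<bar>(x' - y') - (x - y)\<bar> + L * (\<bar>t - s\<bar> + \<bar>x' - x\<bar> + \<bar>y' - y\<bar>) * \<bar>x - y\<bar>"
proof -
  define u u' where "u = x - y" and "u' = x' - y'"
  define \<phi> where "\<phi> z = \<sigma> t (y' + z * u') - \<sigma> s (y + z * u)" for z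
  have "\<exists>z>0. z < 1 \<and> \<phi> 1 - \<phi> 0 = (1 - 0) * (\<sigma>x t (y' + z * u') * u' - \<sigma>x s (y + z * u) * u)"
  proof (rule MVT2)
    fix z :: real
    show "(\<phi> has_real_derivative \<sigma>x t (y' + z * u') * u' - \<sigma>x s (y + z * u) * u) (at z)"
      unfolding \<phi>_def using assms
      by (intro DERIV_diff DERIV_chain2[OF \<sigma>_deriv]) (auto intro!: derivative_eq_intros)
  qed simp
  then obtain z where z: "0 < z" "z < 1"
    and \<phi>: "\<phi> 1 - \<phi> 0 = \<sigma>x t (y' + z * u') * u' - \<sigma>x s (y + z * u) * u" by auto
  define P Q where "P = y' + z * u'" and "Q = y + z * u"
  have "P - Q = (1 - z) * (y' - y) + z * (x' - x)"
    by (simp add: P_def Q_def u_def u'_def algebra_simps)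
  also have "\<bar>\<dots>\<bar> \<le> (1 - z) * \<bar>y' - y\<bar> + z * \<bar>x' - x\<bar>"
    using z by (intro order.trans[OF abs_triangle_ineq]) (simp add: abs_mult)
  also have "\<dots> \<le> 1 * \<bar>y' - y\<bar> + 1 * \<bar>x' - x\<bar>"
    using z by (intro add_mono mult_right_mono) auto
  finally have "\<bar>t - s\<bar> + \<bar>P - Q\<bar> \<le> \<bar>t - s\<bar> + \<bar>x' - x\<bar> + \<bar>y' - y\<bar>" by simp
  then have "L * (\<bar>t - s\<bar> + \<bar>P - Q\<bar>) \<le> L * (\<bar>t - s\<bar> + \<bar>x' - x\<bar> + \<bar>y' - y\<bar>)"
    using L by (rule mult_left_mono)
  then have "\<bar>\<sigma>x t P - \<sigma>x s Q\<bar> \<le> L * (\<bar>t - s\<bar> + \<bar>x' - x\<bar> + \<bar>y' - y\<bar>)"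
    by (rule order.trans[OF \<sigma>x_lipschitz[OF assms]])
  then have 1: "\<bar>(\<sigma>x t P - \<sigma>x s Q) * u\<bar> \<le> L * (\<bar>t - s\<bar> + \<bar>x' - x\<bar> + \<bar>y' - y\<bar>) * \<bar>u\<bar>"
    unfolding abs_mult by (rule mult_right_mono) simp
  have "\<bar>\<sigma>x t P\<bar> \<le> L"
    using \<sigma>_lipschitz[of t t] assms by (intro DERIV_abs_le_lipschitz[OF \<sigma>_deriv]) auto
  then have 2: "\<bar>\<sigma>x t P * (u' - u)\<bar> \<le> L * \<bar>u' - u\<bar>"
    unfolding abs_mult by (rule mult_right_mono) simp
  have "(\<sigma> t x' - \<sigma> t y') - (\<sigma> s x - \<sigma> s y) = \<phi> 1 - \<phi> 0"
    by (simp add: \<phi>_def u_def u'_def)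
  also have "\<dots> = \<sigma>x t P * (u' - u) + (\<sigma>x t P - \<sigma>x s Q) * u"
    unfolding \<phi> P_def Q_def by (simp add: algebra_simps)
  also have "\<bar>\<dots>\<bar> \<le> L * \<bar>u' - u\<bar> + L * (\<bar>t - s\<bar> + \<bar>x' - x\<bar> + \<bar>y' - y\<bar>) * \<bar>u\<bar>"
    by (rule order.trans[OF abs_triangle_ineq add_mono[OF 2 1]])
  finally show ?thesis unfolding u_def u'_def .
qed

lemma continuous_along:
  assumes f: "\<And>s t x y. 0 \<le> s \<Longrightarrow> 0 \<le> t \<Longrightarrow> \<bar>f t x - f s y\<bar> \<le> L * (\<bar>t - s\<bar> + \<bar>x - y\<bar>)"
    and x: "holder_bound \<beta> A {0..T} x"
  shows "continuous_on {0..T} (\<lambda>\<tau>. f \<tau> (x \<tau>))"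
  using holder_bound_along[OF f x order.refl, of T] exponents
  by (intro holder_bound_continuous_on) auto

lemma integral_image_exists:
  assumes x: "holder_bound \<beta> A {0..T} x" and A: "0 \<le> A"
  shows "\<exists>X. integral_image x X"
proof -
  obtain F where F: "young_primitive (\<beta> + \<gamma>) T (\<lambda>\<tau>. \<sigma> \<tau> (x \<tau>)) g F"
    using exponents \<gamma> L A G T
      young_primitive_exists[OF holder_bound_along[OF \<sigma>_lipschitz x, of T] g] by auto
  show ?thesis
    unfolding integral_image_def
    by (rule exI[of _ "\<lambda>t. x0 + integral {0..t} (\<lambda>\<tau>. b \<tau> (x \<tau>)) + F t"]) (use F in blast)
qed

text \<open>The Stieltjes integrals in the definition of a solution exist separately for each \<open>t\<close>; by
  uniqueness they are the values of one Young primitive.\<close>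

lemma holder_solution_iff_integral_image:
  assumes x: "holder_on \<beta> {0..T} x"
  shows "holder_solution b \<sigma> g x0 \<beta> T x \<longleftrightarrow> integral_image x x"
proof -
  obtain A where A: "0 \<le> A" "holder_bound \<beta> A {0..T} x"
    using x holder_on_iff_holder_bound by auto
  have stieltjes: "has_stieltjes_integral (\<lambda>\<tau>. \<sigma> \<tau> (x \<tau>)) g 0 t (F t)"
    if "young_primitive (\<beta> + \<gamma>) T (\<lambda>\<tau>. \<sigma> \<tau> (x \<tau>)) g F" "t \<in> {0..T}" for F t
    using exponents L G A
    by (intro young_primitive_has_stieltjes_integral[OF that(1) _ _ _
          holder_bound_along[OF \<sigma>_lipschitz A(2), of T] holder_bound_subset[OF g] _ _ that(2)]) auto
  show ?thesis
  proof
    assume sol: "holder_solution b \<sigma> g x0 \<beta> T x"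
    obtain F where F: "young_primitive (\<beta> + \<gamma>) T (\<lambda>\<tau>. \<sigma> \<tau> (x \<tau>)) g F"
      using integral_image_exists[OF A(2,1)] unfolding integral_image_def by blast
    have "x t = x0 + integral {0..t} (\<lambda>\<tau>. b \<tau> (x \<tau>)) + F t" if t: "t \<in> {0..T}" for t
    proof -
      obtain J where J: "has_stieltjes_integral (\<lambda>\<tau>. \<sigma> \<tau> (x \<tau>)) g 0 t J"
        "x t = x0 + integral {0..t} (\<lambda>\<tau>. b \<tau> (x \<tau>)) + J"
        using sol t unfolding holder_solution_def by blast
      then show ?thesis using has_stieltjes_integral_unique[OF J(1) stieltjes[OF F t]] by simp
    qed
    then show "integral_image x x" using F unfolding integral_image_def by blast
  next
    assume "integral_image x x"
    then obtain F where F: "young_primitive (\<beta> + \<gamma>) T (\<lambda>\<tau>. \<sigma> \<tau> (x \<tau>)) g F"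
      and eq: "\<And>t. t \<in> {0..T} \<Longrightarrow> x t = x0 + integral {0..t} (\<lambda>\<tau>. b \<tau> (x \<tau>)) + F t"
      unfolding integral_image_def by blast
    show "holder_solution b \<sigma> g x0 \<beta> T x"
      unfolding holder_solution_def
    proof (intro conjI x ballI)
      fix t assume "t \<in> {0..T}"
      then show "\<exists>J. has_stieltjes_integral (\<lambda>\<tau>. \<sigma> \<tau> (x \<tau>)) g 0 t J \<and>
          x t = x0 + integral {0..t} (\<lambda>\<tau>. b \<tau> (x \<tau>)) + J"
        using stieltjes[OF F] eq by (intro exI[of _ "F t"] conjI)
    qed
  qed
qed

text \<open>The three terms are the germ \<open>f s * (g t - g s)\<close>, the remainder of the Young primitive and the
  ordinary integral. Their natural exponents \<open>\<gamma>\<close>, \<open>\<beta> + \<gamma>\<close> and \<open>1\<close> all exceed \<open>\<beta>\<close>, and the excess is traded for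
  a power of \<open>h\<close>.\<close>

lemma increment_bound:
  assumes F: "young_primitive (\<beta> + \<gamma>) T f g F" and f: "holder_bound \<beta> A {s..t} f" and A: "0 \<le> A"
    and S: "\<bar>f s\<bar> \<le> S" and c: "continuous_on {0..T} c" and c_le: "\<And>r. r \<in> {s..t} \<Longrightarrow> \<bar>c r\<bar> \<le> S"
    and st: "0 \<le> s" "s \<le> t" "t \<le> T" "t \<le> s + h" and h: "0 < h"
  shows "\<bar>(integral {0..t} c + F t) - (integral {0..s} c + F s)\<bar>
    \<le> (S * G * h powr (\<gamma> - \<beta>) + K * A * h powr \<gamma> + S * h powr (1 - \<beta>)) * (t - s) powr \<beta>"
proof -
  have split: "(t - s) powr p \<le> h powr (p - \<beta>) * (t - s) powr \<beta>" if "\<beta> \<le> p" for p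
  proof -
    have "(t - s) powr p = (t - s) powr (p - \<beta>) * (t - s) powr \<beta>" by (simp flip: powr_add)
    also have "\<dots> \<le> h powr (p - \<beta>) * (t - s) powr \<beta>"
      using st that by (intro mult_right_mono powr_mono2) auto
    finally show ?thesis .
  qed
  have S0: "0 \<le> S" using S by linarith
  have "\<bar>f s * (g t - g s)\<bar> \<le> S * (G * (t - s) powr \<gamma>)"
    unfolding abs_mult using S S0 st by (intro mult_mono holder_boundD[OF g]) auto
  also have "\<dots> \<le> S * (G * (h powr (\<gamma> - \<beta>) * (t - s) powr \<beta>))"
    using S0 G \<beta> by (intro mult_left_mono split) auto
  finally have 1: "\<bar>f s * (g t - g s)\<bar> \<le> S * G * h powr (\<gamma> - \<beta>) * (t - s) powr \<beta>"
    by (simp only: mult_ac)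
  have "\<bar>F t - F s - f s * (g t - g s)\<bar> \<le> A * G / (1 - 2 powr (1 - (\<beta> + \<gamma>))) * (t - s) powr (\<beta> + \<gamma>)"
    using st exponents A G by (intro young_primitive_bound[OF F] f holder_bound_subset[OF g]) auto
  also have "\<dots> = K * A * (t - s) powr (\<beta> + \<gamma>)" by (simp add: K_def)
  also have "\<dots> \<le> K * A * (h powr (\<beta> + \<gamma> - \<beta>) * (t - s) powr \<beta>)"
    using K_nonneg A exponents by (intro mult_left_mono split) auto
  finally have 2: "\<bar>F t - F s - f s * (g t - g s)\<bar> \<le> K * A * h powr \<gamma> * (t - s) powr \<beta>"
    by (simp add: mult.assoc)
  have int: "c integrable_on {0..t}"
    using st by (intro integrable_continuous_interval continuous_on_subset[OF c]) auto
  have "integral {0..t} c - integral {0..s} c = integral {s..t} c"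
    using Henstock_Kurzweil_Integration.integral_combine[OF st(1,2) int] by simp
  also have "norm \<dots> \<le> S * (t - s)"
    using st c_le by (intro integral_bound continuous_on_subset[OF c]) auto
  also have "\<dots> \<le> S * (h powr (1 - \<beta>) * (t - s) powr \<beta>)"
    using S0 split[of 1] exponents st by (intro mult_left_mono) auto
  finally have 3: "\<bar>integral {0..t} c - integral {0..s} c\<bar> \<le> S * h powr (1 - \<beta>) * (t - s) powr \<beta>"
    by (simp add: mult.assoc)
  show ?thesis using 1 2 3 unfolding distrib_right by linarith
qed

lemma small_step_exists:
  assumes "0 \<le> Q"
  obtains h where "0 < h" "h \<le> 1" "h powr \<gamma> * Q \<le> 1 / 2"
proof
  let ?h = "(1 / (2 * Q + 2)) powr (1 / \<gamma>)"
  show "0 < ?h" using assms by simp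
  have "?h \<le> 1 powr (1 / \<gamma>)" using assms exponents by (intro powr_mono2) auto
  then show "?h \<le> 1" by simp
  show "?h powr \<gamma> * Q \<le> 1 / 2" using assms exponents by (simp add: powr_powr field_simps)
qed

section \<open>Invariance and contraction\<close>

text \<open>The image of a function with constant \<open>R\<close> has constant \<open>P + h powr \<gamma> * Q * R\<close>, where \<open>P\<close> and \<open>Q\<close> come from
  \<open>increment_bound\<close>; \<open>P\<close> collects the part independent of \<open>R\<close>. With \<open>h powr \<gamma> * Q\<close>
  at most \<open>1 / 2\<close>, the choice \<open>R = 2 * P\<close> is reproduced. The germ alone gains only \<open>h powr (\<gamma> - \<beta>)\<close>; the
  missing \<open>h powr \<beta>\<close> comes from bounding the values of \<open>x - x0\<close> by its increments.\<close>

lemma integral_image_invariant: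
  obtains h R where "0 < h" "h \<le> 1" "0 \<le> R"
    and "\<And>x X. x 0 = x0 \<Longrightarrow> weighted_holder \<beta> h T R x \<Longrightarrow> integral_image x X \<Longrightarrow>
      weighted_holder \<beta> h T R X"
proof -
  define S0 where "S0 = \<bar>\<sigma> 0 0\<bar> + \<bar>b 0 0\<bar> + L * (T + \<bar>x0\<bar>)"
  define P where "P = S0 * G + K * L + S0"
  define Q where "Q = 2 * L * G + K * L + 2 * L"
  have S0: "0 \<le> S0" using L T by (simp add: S0_def)
  have P: "0 \<le> P" using S0 G K_nonneg L by (simp add: P_def)
  have Q: "0 \<le> Q" using G K_nonneg L by (simp add: Q_def)
  obtain h where h: "0 < h" "h \<le> 1" "h powr \<gamma> * Q \<le> 1 / 2" using small_step_exists[OF Q] .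
  define R where "R = 2 * P"
  have R: "0 \<le> R" using P by (simp add: R_def)
  have "weighted_holder \<beta> h T R X"
    if x0: "x 0 = x0" and x: "weighted_holder \<beta> h T R x" and X: "integral_image x X" for x X
    unfolding weighted_holder_def
  proof (intro allI impI, elim conjE)
    fix s t assume st: "0 \<le> s" "s \<le> t" "t \<le> T" "t \<le> s + h"
    obtain F where F: "young_primitive (\<beta> + \<gamma>) T (\<lambda>\<tau>. \<sigma> \<tau> (x \<tau>)) g F"
      and XF: "\<And>t. t \<in> {0..T} \<Longrightarrow> X t = x0 + integral {0..t} (\<lambda>\<tau>. b \<tau> (x \<tau>)) + F t"
      using X unfolding integral_image_def by blast
    define w where "w = 2 powr (t / h)"
    have w: "1 \<le> w" using st h by (auto simp: w_def intro!: ge_one_powr_ge_zero)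
    define S where "S = S0 + 2 * L * R * h powr \<beta> * w"
    have sup: "\<bar>x r\<bar> \<le> \<bar>x0\<bar> + 2 * R * h powr \<beta> * w" if "r \<in> {s..t}" for r
    proof -
      have "weighted_holder \<beta> h T R (\<lambda>t. x t - x0)" using x by (simp add: weighted_holder_def)
      then have "\<bar>x r - x0\<bar> \<le> 2 * R * h powr \<beta> * 2 powr (r / h)"
        using weighted_holder_sup_bound[of \<beta> h T R "\<lambda>t. x t - x0" r] x0 R h exponents st that by auto
      also have "\<dots> \<le> 2 * R * h powr \<beta> * w"
        unfolding w_def using that R h by (intro mult_left_mono weight_mono) auto
      finally show ?thesis by linarith
    qed
    have bound: "\<bar>f r (x r)\<bar> \<le> S"
      if f: "\<And>s t x y. 0 \<le> s \<Longrightarrow> 0 \<le> t \<Longrightarrow> \<bar>f t x - f s y\<bar> \<le> L * (\<bar>t - s\<bar> + \<bar>x - y\<bar>)"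
        and f0: "\<bar>f 0 0\<bar> \<le> \<bar>\<sigma> 0 0\<bar> + \<bar>b 0 0\<bar>" and r: "r \<in> {s..t}" for f r
    proof -
      have "\<bar>f r (x r) - f 0 0\<bar> \<le> L * (\<bar>r - 0\<bar> + \<bar>x r - 0\<bar>)" using r st by (intro f) auto
      also have "\<dots> \<le> L * (T + (\<bar>x0\<bar> + 2 * R * h powr \<beta> * w))"
        using r st L sup[OF r] by (intro mult_left_mono add_mono) auto
      also have "\<dots> = L * (T + \<bar>x0\<bar>) + 2 * L * R * h powr \<beta> * w" by (simp add: algebra_simps)
      finally show ?thesis using f0 unfolding S_def S0_def by linarith
    qed
    have xh: "holder_bound \<beta> (R * w) {s..t} x"
      unfolding w_def using st R h by (intro weighted_holder_imp_holder_bound_short[OF x]) auto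
    have fh: "holder_bound \<beta> (L * (1 powr (1 - \<beta>) + R * w)) {s..t} (\<lambda>\<tau>. \<sigma> \<tau> (x \<tau>))"
      using st h by (intro holder_bound_along[OF \<sigma>_lipschitz xh]) auto
    have "\<bar>(integral {0..t} (\<lambda>\<tau>. b \<tau> (x \<tau>)) + F t) - (integral {0..s} (\<lambda>\<tau>. b \<tau> (x \<tau>)) + F s)\<bar>
      \<le> (S * G * h powr (\<gamma> - \<beta>) + K * (L * (1 powr (1 - \<beta>) + R * w)) * h powr \<gamma> + S * h powr (1 - \<beta>)) * (t - s) powr \<beta>"
    proof (rule increment_bound[OF F fh _ _ _ _ st h(1)])
      show "continuous_on {0..T} (\<lambda>\<tau>. b \<tau> (x \<tau>))"
        using weighted_holder_imp_holder_bound[OF x R h(1)] exponents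
        by (intro continuous_along b_lipschitz) auto
    qed (use L R w st in \<open>auto intro!: bound[OF \<sigma>_lipschitz] bound[OF b_lipschitz]\<close>)
    also have "\<dots> \<le> R * w * (t - s) powr \<beta>"
    proof (rule mult_right_mono)
      have hh: "h powr (\<gamma> - \<beta>) \<le> 1" "h powr \<gamma> \<le> 1" "h powr (1 - \<beta>) \<le> 1" "h \<le> h powr \<gamma>"
        using h \<beta> \<gamma> exponents powr_mono2[of _ h 1] powr_mono'[of \<gamma> 1 h]
        by auto
      have hm: "h powr \<beta> * h powr (\<gamma> - \<beta>) = h powr \<gamma>" "h powr \<beta> * h powr (1 - \<beta>) = h"
        using h by (simp_all flip: powr_add)
      have "S * G * h powr (\<gamma> - \<beta>) = S0 * G * h powr (\<gamma> - \<beta>) + 2 * L * G * R * w * (h powr \<beta> * h powr (\<gamma> - \<beta>))"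
        by (simp add: S_def algebra_simps)
      also have "\<dots> \<le> S0 * G * 1 + 2 * L * G * R * w * h powr \<gamma>"
        unfolding hm using S0 G L R w hh by (intro add_mono mult_left_mono) auto
      finally have 1: "S * G * h powr (\<gamma> - \<beta>) \<le> S0 * G + 2 * L * G * R * w * h powr \<gamma>" by simp
      have "K * (L * (1 powr (1 - \<beta>) + R * w)) * h powr \<gamma> = K * L * h powr \<gamma> + K * L * R * w * h powr \<gamma>"
        by (simp add: algebra_simps)
      also have "\<dots> \<le> K * L * 1 + K * L * R * w * h powr \<gamma>"
        using K_nonneg L R w hh by (intro add_mono mult_left_mono) auto
      finally have 2: "K * (L * (1 powr (1 - \<beta>) + R * w)) * h powr \<gamma> \<le> K * L + K * L * R * w * h powr \<gamma>" by simp
      have "S * h powr (1 - \<beta>) = S0 * h powr (1 - \<beta>) + 2 * L * R * w * (h powr \<beta> * h powr (1 - \<beta>))"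
        by (simp add: S_def algebra_simps)
      also have "\<dots> \<le> S0 * 1 + 2 * L * R * w * h powr \<gamma>"
        unfolding hm using S0 L R w hh by (intro add_mono mult_left_mono) auto
      finally have 3: "S * h powr (1 - \<beta>) \<le> S0 + 2 * L * R * w * h powr \<gamma>" by simp
      have "P * 1 \<le> P * w" using P w by (intro mult_left_mono)
      moreover have "P * w = 1 / 2 * (R * w)" "P * 1 = S0 * G + K * L + S0"
        by (simp_all add: R_def P_def)
      moreover have "h powr \<gamma> * Q * (R * w) \<le> 1 / 2 * (R * w)"
        using h R w by (intro mult_right_mono) auto
      moreover have "2 * L * G * R * w * h powr \<gamma> + K * L * R * w * h powr \<gamma> + 2 * L * R * w * h powr \<gamma>
          = h powr \<gamma> * Q * (R * w)"
        by (simp add: Q_def algebra_simps)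
      ultimately show "S * G * h powr (\<gamma> - \<beta>) + K * (L * (1 powr (1 - \<beta>) + R * w)) * h powr \<gamma> + S * h powr (1 - \<beta>) \<le> R * w"
        using 1 2 3 by linarith
    qed simp
    finally show "\<bar>X t - X s\<bar> \<le> R * 2 powr (t / h) * (t - s) powr \<beta>"
      using XF[of s] XF[of t] st by (simp add: w_def)
  qed
  then show ?thesis using that h R by blast
qed

text \<open>Same mechanism as for invariance, applied to the difference of two images: the integrands differ by
  \<open>\<sigma> \<tau> (x \<tau>) - \<sigma> \<tau> (y \<tau>)\<close>, whose increments are controlled by \<open>\<sigma>_four_point\<close>. The step \<open>h\<close> depends on
  the common Hoelder constant \<open>A\<close> but not on \<open>M\<close>, so the estimate can be iterated.\<close>

lemma integral_image_contraction:
  assumes A: "0 \<le> A"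
  obtains h where "0 < h"
    and "\<And>x y X Y M. holder_bound \<beta> A {0..T} x \<Longrightarrow> holder_bound \<beta> A {0..T} y \<Longrightarrow> x 0 = y 0 \<Longrightarrow>
      integral_image x X \<Longrightarrow> integral_image y Y \<Longrightarrow> 0 \<le> M \<Longrightarrow>
      weighted_holder \<beta> h T M (\<lambda>t. x t - y t) \<Longrightarrow> weighted_holder \<beta> h T (M / 2) (\<lambda>t. X t - Y t)"
proof -
  define Q where "Q = 2 * L * G + K * (L * (3 + 4 * A)) + 2 * L"
  have Q: "0 \<le> Q" using G K_nonneg L A by (simp add: Q_def)
  obtain h where h: "0 < h" "h \<le> 1" "h powr \<gamma> * Q \<le> 1 / 2" using small_step_exists[OF Q] .
  have "weighted_holder \<beta> h T (M / 2) (\<lambda>t. X t - Y t)"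
    if x: "holder_bound \<beta> A {0..T} x" and y: "holder_bound \<beta> A {0..T} y" and xy0: "x 0 = y 0"
      and X: "integral_image x X" and Y: "integral_image y Y" and M: "0 \<le> M"
      and xy: "weighted_holder \<beta> h T M (\<lambda>t. x t - y t)" for x y X Y M
    unfolding weighted_holder_def
  proof (intro allI impI, elim conjE)
    fix s t assume st: "0 \<le> s" "s \<le> t" "t \<le> T" "t \<le> s + h"
    obtain F where F: "young_primitive (\<beta> + \<gamma>) T (\<lambda>\<tau>. \<sigma> \<tau> (x \<tau>)) g F"
      and XF: "\<And>t. t \<in> {0..T} \<Longrightarrow> X t = x0 + integral {0..t} (\<lambda>\<tau>. b \<tau> (x \<tau>)) + F t"
      using X unfolding integral_image_def by blast
    obtain H where H: "young_primitive (\<beta> + \<gamma>) T (\<lambda>\<tau>. \<sigma> \<tau> (y \<tau>)) g H"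
      and YH: "\<And>t. t \<in> {0..T} \<Longrightarrow> Y t = x0 + integral {0..t} (\<lambda>\<tau>. b \<tau> (y \<tau>)) + H t"
      using Y unfolding integral_image_def by blast
    define w where "w = 2 powr (t / h)"
    have w: "0 \<le> w" by (simp add: w_def)
    define f where "f \<tau> = \<sigma> \<tau> (x \<tau>) - \<sigma> \<tau> (y \<tau>)" for \<tau>
    define c where "c \<tau> = b \<tau> (x \<tau>) - b \<tau> (y \<tau>)" for \<tau>
    define S where "S = 2 * L * M * h powr \<beta> * w"
    have sup: "\<bar>x r - y r\<bar> \<le> 2 * M * h powr \<beta> * w" if "r \<in> {s..t}" for r
    proof -
      have "\<bar>x r - y r\<bar> \<le> 2 * M * h powr \<beta> * 2 powr (r / h)"
        using weighted_holder_sup_bound[OF xy _ M h(1), of r] xy0 exponents st that by auto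
      also have "\<dots> \<le> 2 * M * h powr \<beta> * w"
        unfolding w_def using that M h by (intro mult_left_mono weight_mono) auto
      finally show ?thesis .
    qed
    have bound: "\<bar>k r (x r) - k r (y r)\<bar> \<le> S"
      if k: "\<And>s t x y. 0 \<le> s \<Longrightarrow> 0 \<le> t \<Longrightarrow> \<bar>k t x - k s y\<bar> \<le> L * (\<bar>t - s\<bar> + \<bar>x - y\<bar>)"
        and r: "r \<in> {s..t}" for k r
    proof -
      have "\<bar>k r (x r) - k r (y r)\<bar> \<le> L * (\<bar>r - r\<bar> + \<bar>x r - y r\<bar>)" using r st by (intro k) auto
      also have "\<dots> \<le> L * (2 * M * h powr \<beta> * w)"
        using L sup[OF r] by (intro mult_left_mono) auto
      finally show ?thesis by (simp add: S_def mult_ac)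
    qed
    have cont: "continuous_on {0..T} (\<lambda>\<tau>. b \<tau> (x \<tau>))" "continuous_on {0..T} (\<lambda>\<tau>. b \<tau> (y \<tau>))"
      using continuous_along[OF b_lipschitz x] continuous_along[OF b_lipschitz y] by auto
    (* 3 + 4 * A = 1 + 2 * (1 + 2 * A): the values of x - y on {s..t} are at most 2 * M * w. *)
    have fh: "holder_bound \<beta> (L * (3 + 4 * A) * M * w) {s..t} f"
      unfolding holder_bound_def
    proof (intro ballI impI)
      fix r q assume rq: "r \<in> {s..t}" "q \<in> {s..t}" "r \<le> q"
      define p where "p = (q - r) powr \<beta>"
      have p: "0 \<le> p" by (simp add: p_def)
      have "q - r = (q - r) powr (1 - \<beta>) * p" using rq by (simp add: p_def flip: powr_add)
      also have "\<dots> \<le> 1 powr (1 - \<beta>) * p"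
        using rq st h exponents p by (intro mult_right_mono powr_mono2) auto
      finally have qr: "\<bar>q - r\<bar> \<le> p" using rq by simp
      have xqr: "\<bar>x q - x r\<bar> \<le> A * p" and yqr: "\<bar>y q - y r\<bar> \<le> A * p"
        unfolding p_def using rq st by (intro holder_boundD[OF x] holder_boundD[OF y]; simp)+
      have "holder_bound \<beta> (M * w) {s..t} (\<lambda>t. x t - y t)"
        unfolding w_def using st M h by (intro weighted_holder_imp_holder_bound_short[OF xy]) auto
      then have uqr: "\<bar>(x q - y q) - (x r - y r)\<bar> \<le> M * w * p"
        unfolding p_def using rq by (rule holder_boundD)
      have "h powr \<beta> \<le> 1 powr \<beta>" using h exponents by (intro powr_mono2) auto
      then have "2 * M * w * h powr \<beta> \<le> 2 * M * w * 1" using M w by (intro mult_left_mono) auto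
      then have ur: "\<bar>x r - y r\<bar> \<le> 2 * M * w" using sup[OF rq(1)] by (simp add: mult_ac)
      have "\<bar>f q - f r\<bar> \<le> L * \<bar>(x q - y q) - (x r - y r)\<bar>
          + L * (\<bar>q - r\<bar> + \<bar>x q - x r\<bar> + \<bar>y q - y r\<bar>) * \<bar>x r - y r\<bar>"
        unfolding f_def using rq st by (intro \<sigma>_four_point) auto
      also have "\<dots> \<le> L * (M * w * p) + L * (p + A * p + A * p) * (2 * M * w)"
        using L A M w p qr xqr yqr uqr ur by (intro add_mono mult_mono mult_left_mono) auto
      also have "\<dots> = L * (3 + 4 * A) * M * w * p" by (simp add: algebra_simps)
      finally show "\<bar>f q - f r\<bar> \<le> L * (3 + 4 * A) * M * w * (q - r) powr \<beta>" by (simp only: p_def)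
    qed
    have "\<bar>(integral {0..t} c + (F t - H t)) - (integral {0..s} c + (F s - H s))\<bar>
      \<le> (S * G * h powr (\<gamma> - \<beta>) + K * (L * (3 + 4 * A) * M * w) * h powr \<gamma> + S * h powr (1 - \<beta>)) * (t - s) powr \<beta>"
    proof (rule increment_bound[OF _ fh _ _ _ _ st h(1)])
      show "young_primitive (\<beta> + \<gamma>) T f g (\<lambda>t. F t - H t)"
        unfolding f_def by (rule young_primitive_diff[OF F H])
      show "continuous_on {0..T} c" unfolding c_def by (intro continuous_intros cont)
      show "\<bar>f s\<bar> \<le> S" unfolding f_def using st by (intro bound \<sigma>_lipschitz) auto
      show "\<bar>c r\<bar> \<le> S" if "r \<in> {s..t}" for r
        unfolding c_def using that by (intro bound b_lipschitz)
    qed (use L A M w in auto)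
    also have "\<dots> \<le> M / 2 * w * (t - s) powr \<beta>"
    proof (rule mult_right_mono)
      have hm: "h powr \<beta> * h powr (\<gamma> - \<beta>) = h powr \<gamma>" "h powr \<beta> * h powr (1 - \<beta>) = h"
        using h by (simp_all flip: powr_add)
      have "h \<le> h powr \<gamma>" using h \<gamma> powr_mono'[of \<gamma> 1 h] by auto
      then have "2 * L * M * w * h \<le> 2 * L * M * w * h powr \<gamma>"
        using L M w by (intro mult_left_mono) auto
      moreover have "S * h powr (1 - \<beta>) = 2 * L * M * w * (h powr \<beta> * h powr (1 - \<beta>))"
        by (simp add: S_def mult_ac)
      moreover have "S * G * h powr (\<gamma> - \<beta>) = 2 * L * G * M * w * (h powr \<beta> * h powr (\<gamma> - \<beta>))"
        by (simp add: S_def mult_ac)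
      moreover have "2 * L * G * M * w * h powr \<gamma> + K * (L * (3 + 4 * A) * M * w) * h powr \<gamma> + 2 * L * M * w * h powr \<gamma>
          = h powr \<gamma> * Q * (M * w)"
        by (simp add: Q_def algebra_simps)
      moreover have "h powr \<gamma> * Q * (M * w) \<le> 1 / 2 * (M * w)"
        using h M w by (intro mult_right_mono) auto
      ultimately show "S * G * h powr (\<gamma> - \<beta>) + K * (L * (3 + 4 * A) * M * w) * h powr \<gamma> + S * h powr (1 - \<beta>) \<le> M / 2 * w"
        unfolding hm by linarith
    qed simp
    finally have est: "\<bar>(integral {0..t} c + (F t - H t)) - (integral {0..s} c + (F s - H s))\<bar>
      \<le> M / 2 * w * (t - s) powr \<beta>" .
    have "X r - Y r = integral {0..r} c + (F r - H r)" if "r \<in> {0..T}" for r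
    proof -
      have "integral {0..r} c = integral {0..r} (\<lambda>\<tau>. b \<tau> (x \<tau>)) - integral {0..r} (\<lambda>\<tau>. b \<tau> (y \<tau>))"
        unfolding c_def using that
        by (intro integral_diff integrable_continuous_interval
            continuous_on_subset[OF cont(1)] continuous_on_subset[OF cont(2)]) auto
      then show ?thesis using XF[OF that] YH[OF that] by simp
    qed
    then show "\<bar>X t - Y t - (X s - Y s)\<bar> \<le> M / 2 * 2 powr (t / h) * (t - s) powr \<beta>"
      using est st by (simp add: w_def)
  qed
  then show ?thesis using that h by blast
qed

section \<open>Uniqueness and existence\<close>

lemma holder_solution_unique:
  assumes x: "holder_solution b \<sigma> g x0 \<beta> T x" and y: "holder_solution b \<sigma> g x0 \<beta> T y"
    and t: "t \<in> {0..T}"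
  shows "y t = x t"
proof -
  obtain A1 A2 where A12: "0 \<le> A1" "holder_bound \<beta> A1 {0..T} x" "0 \<le> A2" "holder_bound \<beta> A2 {0..T} y"
    using x y by (auto simp: holder_solution_def holder_on_iff_holder_bound)
  define A where "A = max A1 A2"
  have A: "0 \<le> A" using A12 by (simp add: A_def)
  have xA: "holder_bound \<beta> A {0..T} x" and yA: "holder_bound \<beta> A {0..T} y"
    using A12 by (auto simp: A_def intro: holder_bound_mono)
  have xx: "integral_image x x" and yy: "integral_image y y"
    using x y holder_solution_iff_integral_image by (auto simp: holder_solution_def)
  have init: "x 0 = y 0" using integral_image_0[OF xx] integral_image_0[OF yy] by simp
  obtain h where h: "0 < h" and contr: "\<And>x y X Y M. holder_bound \<beta> A {0..T} x \<Longrightarrow>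
      holder_bound \<beta> A {0..T} y \<Longrightarrow> x 0 = y 0 \<Longrightarrow>
      integral_image x X \<Longrightarrow> integral_image y Y \<Longrightarrow> 0 \<le> M \<Longrightarrow>
      weighted_holder \<beta> h T M (\<lambda>t. x t - y t) \<Longrightarrow> weighted_holder \<beta> h T (M / 2) (\<lambda>t. X t - Y t)"
    using integral_image_contraction[OF A] by blast
  have W: "weighted_holder \<beta> h T (2 * A * (1 / 2) ^ n) (\<lambda>t. x t - y t)" for n
  proof (induction n)
    case 0
    have "weighted_holder \<beta> h T (2 * A) (\<lambda>t. x t - y t)"
      using A h by (intro weighted_holder_of_holder_bound holder_bound_diff xA yA) auto
    then show ?case by simp
  next
    case (Suc n)
    then show ?case using contr[OF xA yA init xx yy _ Suc] A by simp
  qed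
  have lim: "(\<lambda>n. 2 * (2 * A * (1 / 2) ^ n) * h powr \<beta> * 2 powr (t / h)) \<longlonglongrightarrow> 2 * (2 * A * 0) * h powr \<beta> * 2 powr (t / h)"
    by (intro tendsto_intros LIMSEQ_power_zero) auto
  have "\<bar>x t - y t\<bar> \<le> 2 * (2 * A * (1 / 2) ^ n) * h powr \<beta> * 2 powr (t / h)" for n
    using weighted_holder_sup_bound[OF W _ _ h _ t] init A exponents by simp
  then have "\<bar>x t - y t\<bar> \<le> 2 * (2 * A * 0) * h powr \<beta> * 2 powr (t / h)"
    by (intro LIMSEQ_le_const[OF lim] exI allI impI)
  then show ?thesis by simp
qed

text \<open>Two step lengths occur: \<open>h0\<close> defines the ball that the integral map preserves, and the Hoelder constant
  \<open>A\<close> valid on this ball determines the step length \<open>h\<close> for which the map contracts there.\<close>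

lemma holder_solution_exists: "\<exists>x. holder_solution b \<sigma> g x0 \<beta> T x"
proof -
  obtain h0 R where h0: "0 < h0" and R: "0 \<le> R"
    and inv: "\<And>x X. x 0 = x0 \<Longrightarrow> weighted_holder \<beta> h0 T R x \<Longrightarrow> integral_image x X \<Longrightarrow>
      weighted_holder \<beta> h0 T R X"
    by (rule integral_image_invariant) blast
  define stable where "stable x \<longleftrightarrow> x 0 = x0 \<and> weighted_holder \<beta> h0 T R x" for x
  define A where "A = 4 * R * 2 powr (T / h0)"
  have A: "0 \<le> A" using R by (simp add: A_def)
  have holder: "holder_bound \<beta> A {0..T} x" if "stable x" for x
    unfolding A_def using that R h0 exponents
    by (intro weighted_holder_imp_holder_bound) (auto simp: stable_def)
  have "\<exists>X. integral_image x X \<and> stable X" if "stable x" for x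
    using integral_image_exists[OF holder[OF that] A] integral_image_0 inv that unfolding stable_def by blast
  then obtain \<Phi> where \<Phi>: "\<And>x. stable x \<Longrightarrow> integral_image x (\<Phi> x)" "\<And>x. stable x \<Longrightarrow> stable (\<Phi> x)"
    by metis
  define X where "X n = (\<Phi> ^^ n) (\<lambda>_. x0)" for n
  have X: "stable (X n)" for n
  proof (induction n)
    case 0
    then show ?case using R by (simp add: X_def stable_def weighted_holder_def)
  next
    case (Suc n)
    then show ?case using \<Phi>(2) by (simp add: X_def)
  qed
  have X0: "X n 0 = x0" for n using X by (simp add: stable_def)
  have image: "integral_image (X n) (X (Suc n))" for n using \<Phi>(1)[OF X] by (simp add: X_def)
  obtain h where h: "0 < h" and contr: "\<And>x y X Y M. holder_bound \<beta> A {0..T} x \<Longrightarrow>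
      holder_bound \<beta> A {0..T} y \<Longrightarrow> x 0 = y 0 \<Longrightarrow>
      integral_image x X \<Longrightarrow> integral_image y Y \<Longrightarrow> 0 \<le> M \<Longrightarrow>
      weighted_holder \<beta> h T M (\<lambda>t. x t - y t) \<Longrightarrow> weighted_holder \<beta> h T (M / 2) (\<lambda>t. X t - Y t)"
    using integral_image_contraction[OF A] by blast
  have step: "weighted_holder \<beta> h T (2 * A * (1 / 2) ^ n) (\<lambda>t. X (Suc n) t - X n t)" for n
  proof (induction n)
    case 0
    have "weighted_holder \<beta> h T (2 * A) (\<lambda>t. X (Suc 0) t - X 0 t)"
      using A h by (intro weighted_holder_of_holder_bound holder_bound_diff holder X) auto
    then show ?case by simp
  next
    case (Suc n)
    then show ?case using contr[OF holder[OF X] holder[OF X] _ image image _ Suc] A X0 by simp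
  qed
  have tail: "weighted_holder \<beta> h T (4 * A * (1 / 2) ^ n) (\<lambda>t. X m t - X n t)" if "n \<le> m" for n m
  proof -
    have "weighted_holder \<beta> h T (4 * A * ((1 / 2) ^ n - (1 / 2) ^ m)) (\<lambda>t. X m t - X n t)"
      using that
    proof (induction m rule: dec_induct)
      case base
      then show ?case by (simp add: weighted_holder_def)
    next
      case (step m)
      show ?case
        using weighted_holder_add[OF \<open>weighted_holder \<beta> h T (2 * A * (1 / 2) ^ m) (\<lambda>t. X (Suc m) t - X m t)\<close> step.IH]
        by (simp add: algebra_simps)
    qed
    then show ?thesis
      by (rule weighted_holder_mono) (use A in \<open>intro mult_left_mono, auto\<close>)
  qed
  have small: "(\<lambda>n. 2 * (C * (1 / 2) ^ n) * h powr \<beta> * 2 powr (t / h)) \<longlonglongrightarrow> 0" for C t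
  proof -
    have "(\<lambda>n. 2 * (C * (1 / 2) ^ n) * h powr \<beta> * 2 powr (t / h)) \<longlonglongrightarrow> 2 * (C * 0) * h powr \<beta> * 2 powr (t / h)"
      by (intro tendsto_intros LIMSEQ_power_zero) auto
    then show ?thesis by simp
  qed
  have "convergent (\<lambda>n. X n t)" if t: "t \<in> {0..T}" for t
  proof (rule convergent_by_tail_bound[OF _ small])
    show "\<bar>X m t - X n t\<bar> \<le> 2 * (4 * A * (1 / 2) ^ n) * h powr \<beta> * 2 powr (t / h)" if "n \<le> m" for m n
      using weighted_holder_sup_bound[OF tail[OF that] _ _ h _ t] X0 A exponents by simp
  qed
  then obtain x where lim: "\<And>t. t \<in> {0..T} \<Longrightarrow> (\<lambda>n. X n t) \<longlonglongrightarrow> x t"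
    unfolding convergent_def by metis
  have x0: "x 0 = x0"
    using lim[of 0] T X0 LIMSEQ_unique[OF _ tendsto_const] by fastforce
  have x: "stable x"
    using weighted_holder_limit[of 0 \<beta> h0 T R X x] X lim x0 unfolding stable_def by blast
  have dist: "weighted_holder \<beta> h T (4 * A * (1 / 2) ^ n) (\<lambda>t. x t - X n t)" for n
  proof (rule weighted_holder_limit[where N = n and U = "\<lambda>m t. X m t - X n t"])
    show "(\<lambda>m. X m t - X n t) \<longlonglongrightarrow> x t - X n t" if "t \<in> {0..T}" for t
      by (intro tendsto_intros lim that)
  qed (rule tail)
  have fixed: "\<Phi> x t = x t" if t: "t \<in> {0..T}" for t
  proof -
    have "\<bar>\<Phi> x t - X (Suc n) t\<bar> \<le> 2 * (2 * A * (1 / 2) ^ n) * h powr \<beta> * 2 powr (t / h)" for n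
    proof -
      have "weighted_holder \<beta> h T (4 * A * (1 / 2) ^ n / 2) (\<lambda>t. \<Phi> x t - X (Suc n) t)"
        using A X0 x0 by (intro contr[OF holder[OF x] holder[OF X] _ \<Phi>(1)[OF x] image _ dist]) auto
      moreover have "\<Phi> x 0 = x0" using \<Phi>(2)[OF x] by (simp add: stable_def)
      ultimately show ?thesis
        using weighted_holder_sup_bound[of \<beta> h T "4 * A * (1 / 2) ^ n / 2" "\<lambda>t. \<Phi> x t - X (Suc n) t" t] 
          A X0 exponents h t by simp
    qed
    then have "(\<lambda>n. \<Phi> x t - X (Suc n) t) \<longlonglongrightarrow> 0"
      by (intro Lim_null_comparison[OF _ small] eventuallyI) (simp only: real_norm_def)
    moreover have "(\<lambda>n. \<Phi> x t - X (Suc n) t) \<longlonglongrightarrow> \<Phi> x t - x t"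
      by (intro tendsto_diff tendsto_const LIMSEQ_Suc lim t)
    ultimately have "\<Phi> x t - x t = 0" by (rule LIMSEQ_unique[rotated])
    then show ?thesis by simp
  qed
  have "integral_image x x"
    using \<Phi>(1)[OF x] fixed unfolding integral_image_def by simp
  moreover have "holder_on \<beta> {0..T} x"
    using holder[OF x] A holder_on_iff_holder_bound by blast
  ultimately show ?thesis using holder_solution_iff_integral_image by blast
qed

end

lemma globally_lipschitzE:
  assumes "globally_lipschitz f"
  obtains L where "0 \<le> L"
    and "\<And>s t x y. 0 \<le> s \<Longrightarrow> 0 \<le> t \<Longrightarrow> \<bar>f t x - f s y\<bar> \<le> L * (\<bar>t - s\<bar> + \<bar>x - y\<bar>)"
proof -
  obtain L where L: "L-lipschitz_on ({0..} \<times> UNIV) (\<lambda>(t, x). f t x)"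
    using assms unfolding globally_lipschitz_def by blast
  have L0: "0 \<le> L" by (rule lipschitz_on_nonneg[OF L])
  have "\<bar>f t x - f s y\<bar> \<le> L * (\<bar>t - s\<bar> + \<bar>x - y\<bar>)" if "0 \<le> s" "0 \<le> t" for s t x y
  proof -
    have "\<bar>f t x - f s y\<bar> \<le> L * dist (t, x) (s, y)"
      using lipschitz_onD[OF L, of "(t, x)" "(s, y)"] that by (simp add: dist_real_def)
    also have "\<dots> \<le> L * (\<bar>t - s\<bar> + \<bar>x - y\<bar>)"
      using sqrt_sum_squares_le_sum_abs[of "t - s" "x - y"] L0
      by (intro mult_left_mono) (simp_all add: dist_Pair_Pair dist_real_def)
    finally show ?thesis .
  qed
  then show ?thesis using that L0 by blast
qed

theorem theorem3:
  fixes b \<sigma> \<sigma>t \<sigma>x :: "real \<Rightarrow> real \<Rightarrow> real" and g :: "real \<Rightarrow> real"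
    and \<gamma> \<beta> x0 T :: real
  assumes "1/2 < \<gamma>" and "\<gamma> \<le> 1"
    and "holder_on \<gamma> UNIV g"
    and "globally_lipschitz b"
    and "C1_with_partials \<sigma> \<sigma>t \<sigma>x"
    and "globally_lipschitz \<sigma>" and "globally_lipschitz \<sigma>t" and "globally_lipschitz \<sigma>x"
    and "T > 0" and "\<beta> < \<gamma>" and "1 - \<gamma> < \<beta>"
  shows "\<exists>x. holder_solution b \<sigma> g x0 \<beta> T x \<and>
           (\<forall>y. holder_solution b \<sigma> g x0 \<beta> T y \<longrightarrow> (\<forall>t\<in>{0..T}. y t = x t))"
proof -
  obtain G where G: "0 \<le> G" "holder_bound \<gamma> G UNIV g"
    using assms(3) holder_on_iff_holder_bound by auto
  obtain Lb where Lb: "0 \<le> Lb"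
    "\<And>s t x y. 0 \<le> s \<Longrightarrow> 0 \<le> t \<Longrightarrow> \<bar>b t x - b s y\<bar> \<le> Lb * (\<bar>t - s\<bar> + \<bar>x - y\<bar>)"
    using globally_lipschitzE[OF assms(4)] by blast
  obtain Ls where Ls: "0 \<le> Ls"
    "\<And>s t x y. 0 \<le> s \<Longrightarrow> 0 \<le> t \<Longrightarrow> \<bar>\<sigma> t x - \<sigma> s y\<bar> \<le> Ls * (\<bar>t - s\<bar> + \<bar>x - y\<bar>)"
    using globally_lipschitzE[OF assms(6)] by blast
  obtain Lx where Lx: "0 \<le> Lx"
    "\<And>s t x y. 0 \<le> s \<Longrightarrow> 0 \<le> t \<Longrightarrow> \<bar>\<sigma>x t x - \<sigma>x s y\<bar> \<le> Lx * (\<bar>t - s\<bar> + \<bar>x - y\<bar>)"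
    using globally_lipschitzE[OF assms(8)] by blast
  define L where "L = max Lb (max Ls Lx)"
  have le: "c * (\<bar>t - s\<bar> + \<bar>x - y\<bar>) \<le> L * (\<bar>t - s\<bar> + \<bar>x - y\<bar>)" if "c \<le> L" for c s t x y :: real
    using that by (intro mult_right_mono) auto
  interpret young_equation b \<sigma> \<sigma>x g \<gamma> \<beta> x0 T L G
  proof
    show "0 \<le> L" using Lb(1) by (simp add: L_def)
    show "\<bar>b t x - b s y\<bar> \<le> L * (\<bar>t - s\<bar> + \<bar>x - y\<bar>)" if "0 \<le> s" "0 \<le> t" for s t x y
      by (rule order.trans[OF Lb(2)[OF that] le]) (simp add: L_def)
    show "\<bar>\<sigma> t x - \<sigma> s y\<bar> \<le> L * (\<bar>t - s\<bar> + \<bar>x - y\<bar>)" if "0 \<le> s" "0 \<le> t" for s t x y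
      by (rule order.trans[OF Ls(2)[OF that] le]) (simp add: L_def)
    show "\<bar>\<sigma>x t x - \<sigma>x s y\<bar> \<le> L * (\<bar>t - s\<bar> + \<bar>x - y\<bar>)" if "0 \<le> s" "0 \<le> t" for s t x y
      by (rule order.trans[OF Lx(2)[OF that] le]) (simp add: L_def)
    show "((\<lambda>y. \<sigma> t y) has_real_derivative \<sigma>x t x) (at x)" if "0 \<le> t" for t x
      using assms(5) that unfolding C1_with_partials_def by blast
  qed (rule assms G)+
  obtain x where "holder_solution b \<sigma> g x0 \<beta> T x" using holder_solution_exists by blast
  then show ?thesis using holder_solution_unique by blast
qed

end
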